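(* Let $X\sim p_X(\|x-\mu\|^2)$ and $Y\sim q_Y(\|y-\mu\|^2)$, $x,y,\mu\in\mathbb{R}^p$, be scale mixtures of normals with $X-\mu\sim SN_p(G)$, $Y-\mu\sim SN_p(H)$, and consider estimating $q_Y(\|y-\mu\|^2)$ under integrated $L_1$ loss based on $X$. Let $Z$ be a random variable with cdf $F_Z$ such that $$Z=^d\frac{4Z_1Z_2}{Z_1+4Z_2},\quad\text{with }(Z_1,Z_2)\sim d\tau(z_1,z_2)\propto\frac{z_2^{(p-1)/2}}{(z_1+4z_2)^{p/2}}\,dG(z_1)\,dH(z_2).$$ (a) For $p>1$, the plug-in density estimator $q_Y(\|y-\hat\mu(X)\|^2)$ dominates the plug-in density $q_Y(\|y-X\|^2)$ provided $\hat\mu(X')$ dominates $X'$ under loss $\|\hat\mu-\mu\|^2$ for $X'\sim p^*(\|x-\mu\|^2)$, with $$p^*(\|s\|^2)=\frac{K}{\|s\|}\int_{(0,\infty)}(2\pi z)^{-p/2}\,e^{-\frac{\|s\|^2}{2z}}\,dF_Z(z),\qquad s\in\mathbb{R}^p,$$ $K$ being the normalizing constant. (b) In particular, a plug-in Baranchik density estimator $q_Y(\|y-\hat\mu_{a,r(\cdot)}(X)\|^2)$, with $\hat\mu_{a,r(\cdot)}(X)=\left(1-a\,\frac{r(X'X)}{X'X}\right)X$ (here $X'X=\|X\|^2$), dominates the plug-in density $q_Y(\|y-X\|^2)$ provided: $0\le r(\cdot)\le1$ and $r(\cdot)\ne0$; $r(t)$ is non-decreasing for $t>0$; $r(t)/t$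 is non-increasing for $t>0$; $p\ge4$; the expectations $E(Z^{1/2})$ and $E(Z^{-3/2})$ are finite; and $$0<a\le2(p-3)\,\frac{E(Z^{-1/2})}{E(Z^{-3/2})}.$$
   Context: A density $g$ on $\mathbb{R}^p$ is a scale mixture of normals, written $SN_p(G)$, if $g(x)=\int_{\mathbb{R}_+}(2\pi v)^{-p/2}e^{-\|x\|^2/(2v)}\,dG(v)$ for a cdf $G$ on $\mathbb{R}_+$. It is further assumed that $E(V^{-p/2})<\infty$ for $V\sim G$ and $E(W^{-p/2})<\infty$ for $W\sim H$. The integrated $L_1$ loss of an estimate $\hat q(\cdot;x)$ is $\int_{\mathbb{R}^p}|q_Y(\|y-\mu\|^2)-\hat q(y;x)|\,dy$; risk is the expectation over $X$. One estimator dominates another if its risk is $\le$ for all $\mu$ with strict inequality for some $\mu$ (same definition for point estimators under a given loss). *)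

theory Defs
  imports "HOL-Probability.Probability"
begin

text \<open>
  Laws on \<open>\<real>\<^sub>+\<close> are given by the probability measure \<open>G\<close> with the cdf in question, so that
  \<open>dG\<close> is integration with respect to \<open>G\<close>.  The moment condition \<open>E (V\<^sup>-\<^sup>p\<^sup>/\<^sup>2) < \<infinity>\<close> excludes
  an atom at \<open>0\<close>; this is required explicitly, because \<open>0 powr a = 0\<close>.
\<close>

definition mixing_law :: "nat \<Rightarrow> real measure \<Rightarrow> bool" where
  "mixing_law p G \<longleftrightarrow> real_distribution G \<and> (AE v in G. 0 < v)
     \<and> integrable G (\<lambda>v. v powr (- (real p / 2)))"

definition normal_kernel :: "real \<Rightarrow> real ^ 'p \<Rightarrow> real" where
  "normal_kernel v s =
     (2 * pi * v) powr (- (real CARD('p) / 2)) * exp (- ((norm s)\<^sup>2 / (2 * v)))"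

definition SN :: "real measure \<Rightarrow> real ^ 'p \<Rightarrow> real" where
  "SN G s = (\<integral>v. normal_kernel v s \<partial>G)"

definition location_family :: "(real ^ 'p \<Rightarrow> real) \<Rightarrow> real ^ 'p \<Rightarrow> (real ^ 'p) measure" where
  "location_family f \<mu> = density lborel (\<lambda>x. ennreal (f (x - \<mu>)))"

text \<open>
  Losses and risks take values in \<open>[0, \<infinity>]\<close>, so that no integrability is presupposed.
\<close>

definition risk ::
  "('m \<Rightarrow> 'x measure) \<Rightarrow> ('m \<Rightarrow> 'd \<Rightarrow> ennreal) \<Rightarrow> ('x \<Rightarrow> 'd) \<Rightarrow> 'm \<Rightarrow> ennreal" where
  "risk P L \<delta> \<mu> = (\<integral>\<^sup>+ x. L \<mu> (\<delta> x) \<partial>(P \<mu>))"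

definition dominates ::
  "('m \<Rightarrow> 'x measure) \<Rightarrow> ('m \<Rightarrow> 'd \<Rightarrow> ennreal) \<Rightarrow> ('x \<Rightarrow> 'd) \<Rightarrow> ('x \<Rightarrow> 'd) \<Rightarrow> bool" where
  "dominates P L \<delta> \<delta>' \<longleftrightarrow>
     (\<forall>\<mu>. risk P L \<delta> \<mu> \<le> risk P L \<delta>' \<mu>) \<and> (\<exists>\<mu>. risk P L \<delta> \<mu> < risk P L \<delta>' \<mu>)"

definition L1_loss :: "(real \<Rightarrow> real) \<Rightarrow> real ^ 'p \<Rightarrow> (real ^ 'p \<Rightarrow> real) \<Rightarrow> ennreal" where
  "L1_loss q \<mu> g = (\<integral>\<^sup>+ y. ennreal \<bar>q ((norm (y - \<mu>))\<^sup>2) - g y\<bar> \<partial>lborel)"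

definition sq_loss :: "real ^ 'p \<Rightarrow> real ^ 'p \<Rightarrow> ennreal" where
  "sq_loss \<mu> d = ennreal ((norm (d - \<mu>))\<^sup>2)"

definition plug_in ::
  "(real \<Rightarrow> real) \<Rightarrow> (real ^ 'p \<Rightarrow> real ^ 'p) \<Rightarrow> real ^ 'p \<Rightarrow> real ^ 'p \<Rightarrow> real" where
  "plug_in q m x = (\<lambda>y. q ((norm (y - m x))\<^sup>2))"

definition baranchik :: "real \<Rightarrow> (real \<Rightarrow> real) \<Rightarrow> real ^ 'p \<Rightarrow> real ^ 'p" where
  "baranchik a r x = (1 - a * r (x \<bullet> x) / (x \<bullet> x)) *\<^sub>R x"

definition tau_weight :: "nat \<Rightarrow> real \<times> real \<Rightarrow> real" where
  "tau_weight p = (\<lambda>(z1, z2).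
     z2 powr ((real p - 1) / 2) / (z1 + 4 * z2) powr (real p / 2))"

definition tau :: "nat \<Rightarrow> real measure \<Rightarrow> real measure \<Rightarrow> (real \<times> real) measure" where
  "tau p G H = density (G \<Otimes>\<^sub>M H)
     (\<lambda>z. ennreal (tau_weight p z / (\<integral>w. tau_weight p w \<partial>(G \<Otimes>\<^sub>M H))))"

definition Z_law :: "nat \<Rightarrow> real measure \<Rightarrow> real measure \<Rightarrow> real measure" where
  "Z_law p G H = distr (tau p G H) borel (\<lambda>(z1, z2). 4 * z1 * z2 / (z1 + 4 * z2))"

definition pstar_kernel :: "real measure \<Rightarrow> real ^ 'p \<Rightarrow> real" where
  "pstar_kernel F s = 1 / norm s * (LINT z:{0<..}|F. normal_kernel z s)"

text \<open>
  \<open>p\<^sup>*(\<parallel>s\<parallel>\<^sup>2)\<close> as a function of \<open>s\<close>.  Its value at the null set \<open>{0}\<close>, where the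
  expression \<open>K / \<parallel>s\<parallel>\<close> is singular, is immaterial.
\<close>

definition pstar :: "real measure \<Rightarrow> real ^ 'p \<Rightarrow> real" where
  "pstar F s = (let K = 1 / integral\<^sup>L lborel (pstar_kernel F :: real ^ 'p \<Rightarrow> real) in K * pstar_kernel F s)"

end

theory Submission
  imports Defs
begin

text \<open>
  The \<open>L\<^sub>1\<close> distance between \<open>q\<^sub>Y\<close> and a translate of it depends only on the length \<open>d\<close> of the translation.  For a normal law with
  variance \<open>w\<close> it is twice the mass that the one-dimensional law \<open>N(0, w)\<close> gives to \<open>[- d / 2, d / 2]\<close>
  (\<open>nn_integral_normal_kernel_shift\<close>), and distances of mixtures are mixtures of distances (\<open>abs_SN_diff\<close>).  As a function
  of \<open>d\<^sup>2\<close> this loss is strictly concave, so it lies below its tangents: passing from \<open>X\<close> to another estimate changes the loss by at most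
  the slope at \<open>\<parallel>X - \<mu>\<parallel>\<^sup>2\<close> times the change in squared error (\<open>mixed_L1_distance_tangent\<close>).  Averaging over \<open>X\<close> multiplies the slope by the
  sampling density, and this product is, up to a constant, \<open>p\<^sup>*\<close>: multiplying two Gaussian exponentials
  adds the reciprocals of \<open>z\<^sub>1\<close> and \<open>4 z\<^sub>2\<close>, which produces \<open>Z\<close> (\<open>density_slope_eq_kernel\<close>).  Hence a smaller quadratic
  risk under \<open>p\<^sup>*\<close> forces a smaller \<open>L\<^sub>1\<close> risk (\<open>L1_risk_improvement\<close>), which is part (a).

  For part (b) the quadratic risk of a Baranchik estimator under \<open>p\<^sup>*\<close> has to be bounded.  Since \<open>1 / \<parallel>s\<parallel>\<close> is a Gaussian integral, \<open>p\<^sup>*\<close> is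
  again a scale mixture of normals (\<open>normal_kernel_div_norm_mixture\<close>), and Strawderman's argument applies.  For a fixed variance \<open>v\<close>, a form of
  Stein's inequality for nondecreasing functions (\<open>stein_inequality\<close>) bounds the change of the risk by
  \<open>a g(v) (a / v - 2 (p - 2))\<close>, where \<open>g(v) = v E (r (\<parallel>X\<parallel>\<^sup>2) / \<parallel>X\<parallel>\<^sup>2)\<close>.  The function \<open>g\<close> is nondecreasing (\<open>shrinkage_gain_mono\<close>) and the
  last factor is decreasing in \<open>v\<close>, so the average over \<open>v\<close> is at most zero as soon as \<open>a E (1 / V) \<le> 2 (p - 2)\<close>; this is the
  hypothesis on \<open>a\<close> once the mixing law is expressed through \<open>Z\<close> (\<open>pstar_risk_baranchik\<close>).  The
  strict inequality at some \<open>\<mu>\<close> comes from strict concavity of the loss, because the estimator changes the length of \<open>x\<close> on a set of positive measure.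
\<close>

section \<open>Gaussian kernels\<close>

lemma normal_kernel_nonneg [simp]: "0 \<le> normal_kernel v s"
  by (simp add: normal_kernel_def)

lemma normal_kernel_pos: "0 < v \<Longrightarrow> 0 < normal_kernel v s"
  by (simp add: normal_kernel_def)

lemma normal_kernel_le_iff:
  fixes y d :: "real ^ 'p"
  assumes "0 < v"
  shows "normal_kernel v y \<le> normal_kernel v d \<longleftrightarrow> norm d \<le> norm y"
proof -
  have "normal_kernel v y \<le> normal_kernel v d \<longleftrightarrow> (norm d)\<^sup>2 \<le> (norm y)\<^sup>2"
    using assms by (simp add: normal_kernel_def divide_le_cancel)
  then show ?thesis by simp
qed

lemma measurable_normal_kernel [measurable]:
  "case_prod normal_kernel \<in> borel_measurable (borel \<Otimes>\<^sub>M (borel :: (real ^ 'p) measure))"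
  unfolding normal_kernel_def case_prod_beta by measurable

lemma normal_kernel_eq_prod:
  fixes s :: "real ^ 'p"
  assumes "0 < v"
  shows "normal_kernel v s = (\<Prod>b\<in>Basis. normal_density 0 (sqrt v) (s \<bullet> b))"
proof -
  have *: "(2 * pi * v) powr (- (real n / 2)) = (1 / sqrt (2 * pi * v)) ^ n" for n
  proof -
    have "(2 * pi * v) powr (- (real n / 2)) = ((2 * pi * v) powr (- 1/2)) powr real n"
      by (simp add: powr_powr)
    also have "\<dots> = (1 / sqrt (2 * pi * v)) ^ n"
      using assms by (simp add: powr_realpow powr_minus powr_half_sqrt field_simps)
    finally show ?thesis .
  qed
  have "(norm s)\<^sup>2 = (\<Sum>b\<in>Basis. (s \<bullet> b)\<^sup>2)"
    unfolding power2_norm_eq_inner by (subst euclidean_inner) (simp add: power2_eq_square)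
  then have "normal_kernel v s
      = (1 / sqrt (2 * pi * v)) ^ CARD('p) * exp (\<Sum>b\<in>Basis. - ((s \<bullet> b)\<^sup>2 / (2 * v)))"
    by (simp add: normal_kernel_def * sum_divide_distrib sum_negf)
  then show ?thesis
    using assms by (simp add: normal_density_def prod_dividef exp_sum power_one_over)
qed

lemma nn_integral_translate:
  fixes f :: "'a::euclidean_space \<Rightarrow> ennreal"
  assumes [measurable]: "f \<in> borel_measurable borel"
  shows "(\<integral>\<^sup>+x. f (x + t) \<partial>lborel) = (\<integral>\<^sup>+x. f x \<partial>lborel)"
  by (subst (2) lborel_affine[of 1 t]) (simp_all add: nn_integral_density nn_integral_distr add.commute)

lemma nn_integral_reflect:
  fixes f :: "'a::euclidean_space \<Rightarrow> ennreal"
  assumes [measurable]: "f \<in> borel_measurable borel"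
  shows "(\<integral>\<^sup>+x. f (t - x) \<partial>lborel) = (\<integral>\<^sup>+x. f x \<partial>lborel)"
  by (subst (2) lborel_affine[of "-1" t]) (simp_all add: nn_integral_density nn_integral_distr)

lemma nn_integral_dilate:
  fixes f :: "'a::euclidean_space \<Rightarrow> ennreal"
  assumes [measurable]: "f \<in> borel_measurable borel" and c: "0 < c"
  shows "(\<integral>\<^sup>+x. f x \<partial>lborel) = ennreal (c ^ DIM('a)) * (\<integral>\<^sup>+x. f (c *\<^sub>R x) \<partial>lborel)"
  using c by (subst lborel_affine[of c 0])
     (simp_all add: nn_integral_density nn_integral_distr nn_integral_cmult prod_constant)

lemma nn_integral_normal_kernel:
  assumes "0 < v"
  shows "(\<integral>\<^sup>+x. ennreal (normal_kernel v (x :: real ^ 'p)) \<partial>lborel) = 1"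
proof -
  have "(\<integral>\<^sup>+x. ennreal (normal_kernel v (x :: real ^ 'p)) \<partial>lborel)
      = (\<integral>\<^sup>+x. (\<Prod>b\<in>Basis. ennreal (normal_density 0 (sqrt v) (x \<bullet> b))) \<partial>(lborel :: (real ^ 'p) measure))"
    using assms by (simp add: normal_kernel_eq_prod prod_ennreal)
  also have "\<dots> = 1"
    using assms by (subst nn_integral_lborel_prod) (simp_all add: nn_integral_eq_integral)
  finally show ?thesis .
qed

text \<open>
  The usual uniqueness argument for Haar measure: the measure \<open>A \<mapsto> lborel (f -` A)\<close> is
  translation invariant, so integrating \<open>g (f y) n (x + f y)\<close> in both orders and shifting identifies it
  with \<open>lborel\<close> up to the ratio of the masses of \<open>n\<close>.  For a Gaussian \<open>n\<close> these masses agree, because \<open>n\<close> is itself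
  invariant under \<open>f\<close>.
\<close>

lemma nn_integral_orthogonal:
  fixes f :: "real ^ 'p \<Rightarrow> real ^ 'p"
  assumes f: "orthogonal_transformation f" and [measurable]: "g \<in> borel_measurable borel"
  shows "(\<integral>\<^sup>+y. g (f y) \<partial>lborel) = (\<integral>\<^sup>+y. g y \<partial>lborel)"
proof -
  have lin: "linear f" and bij: "bij f"
    using f by (auto simp: orthogonal_transformation_linear orthogonal_transformation_bij)
  then have [measurable]: "f \<in> borel_measurable borel"
    by (intro borel_measurable_continuous_onI linear_continuous_on linear_conv_bounded_linear[THEN iffD1])
  let ?n = "\<lambda>x :: real ^ 'p. ennreal (normal_kernel 1 x)"
  have shift: "f (y + inv f (- x)) = f y - x" for x y
    using lin bij by (simp add: linear_add bij_is_surj surj_f_inv_f)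
  have nf: "?n (f y) = ?n y" for y
    using f by (simp add: normal_kernel_def orthogonal_transformation_norm)
  have "(\<integral>\<^sup>+y. g (f y) \<partial>lborel) = (\<integral>\<^sup>+y. g (f y) * (\<integral>\<^sup>+x. ?n (x + f y) \<partial>lborel) \<partial>lborel)"
    by (subst nn_integral_translate) (simp_all add: nn_integral_normal_kernel)
  also have "\<dots> = (\<integral>\<^sup>+y. \<integral>\<^sup>+x. g (f y) * ?n (x + f y) \<partial>lborel \<partial>lborel)"
    by (simp add: nn_integral_cmult)
  also have "\<dots> = (\<integral>\<^sup>+x. \<integral>\<^sup>+y. g (f y) * ?n (x + f y) \<partial>lborel \<partial>lborel)"
    by (rule lborel_pair.Fubini') simp
  also have "\<dots> = (\<integral>\<^sup>+x. \<integral>\<^sup>+y. g (f y - x) * ?n y \<partial>lborel \<partial>lborel)"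
  proof (rule nn_integral_cong)
    fix x
    have "(\<integral>\<^sup>+y. g (f y) * ?n (x + f y) \<partial>lborel)
        = (\<integral>\<^sup>+y. g (f (y + inv f (- x))) * ?n (x + f (y + inv f (- x))) \<partial>lborel)"
      by (rule nn_integral_translate[symmetric]) simp
    then show "(\<integral>\<^sup>+y. g (f y) * ?n (x + f y) \<partial>lborel) = (\<integral>\<^sup>+y. g (f y - x) * ?n y \<partial>lborel)"
      by (simp add: shift nf)
  qed
  also have "\<dots> = (\<integral>\<^sup>+y. \<integral>\<^sup>+x. g (f y - x) * ?n y \<partial>lborel \<partial>lborel)"
    by (rule lborel_pair.Fubini') simp
  also have "\<dots> = (\<integral>\<^sup>+y. (\<integral>\<^sup>+x. g x \<partial>lborel) * ?n y \<partial>lborel)"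
    by (simp add: nn_integral_multc nn_integral_reflect)
  also have "\<dots> = (\<integral>\<^sup>+y. g y \<partial>lborel)"
    by (simp add: nn_integral_cmult nn_integral_normal_kernel)
  finally show ?thesis .
qed

text \<open>
  Rotate the unit vector \<open>e\<close> to a coordinate axis; the kernel is a product over the
  coordinates, and all the others integrate to one.
\<close>

lemma nn_integral_normal_kernel_marginal:
  fixes e :: "real ^ 'p"
  assumes v: "0 < v" and e: "norm e = 1" and [measurable]: "g \<in> borel_measurable borel"
  shows "(\<integral>\<^sup>+x. g (x \<bullet> e) * ennreal (normal_kernel v x) \<partial>lborel)
    = (\<integral>\<^sup>+u. g u * ennreal (normal_density 0 (sqrt v) u) \<partial>lborel)"
proof -
  obtain b0 :: "real ^ 'p" where b0: "b0 \<in> Basis" using nonempty_Basis by blast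
  then have "norm b0 = 1" by simp
  with e obtain f where f: "orthogonal_transformation f" "f b0 = e"
    using orthogonal_transformation_exists[of b0 e] by auto
  have [measurable]: "f \<in> borel_measurable borel"
    using f(1) by (intro borel_measurable_continuous_onI linear_continuous_on
      linear_conv_bounded_linear[THEN iffD1] orthogonal_transformation_linear)
  define h where "h b u = (if b = b0 then g u else 1) * ennreal (normal_density 0 (sqrt v) u)"
    for b :: "real ^ 'p" and u
  have [measurable]: "h b \<in> borel_measurable borel" for b
    unfolding h_def by (cases "b = b0") simp_all
  have h1: "(\<integral>\<^sup>+u. h b u \<partial>lborel) = 1" if "b \<noteq> b0" for b
    using that v by (simp add: h_def nn_integral_eq_integral)
  have "(\<integral>\<^sup>+x. g (x \<bullet> e) * ennreal (normal_kernel v x) \<partial>lborel)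
      = (\<integral>\<^sup>+x. g (f x \<bullet> e) * ennreal (normal_kernel v (f x)) \<partial>lborel)"
    by (rule nn_integral_orthogonal[OF f(1), symmetric]) simp
  also have "\<dots> = (\<integral>\<^sup>+x. g (x \<bullet> b0) * ennreal (normal_kernel v x) \<partial>lborel)"
    using f by (simp add: normal_kernel_def orthogonal_transformation_norm
      f(2)[symmetric] orthogonal_transformation_def del: f(2))
  also have "\<dots> = (\<integral>\<^sup>+x. (\<Prod>b\<in>Basis. h b (x \<bullet> b)) \<partial>lborel)"
  proof (rule nn_integral_cong)
    fix x
    show "g (x \<bullet> b0) * ennreal (normal_kernel v x) = (\<Prod>b\<in>Basis. h b (x \<bullet> b))"
      using b0 v unfolding h_def prod.distrib
      by (simp add: normal_kernel_eq_prod prod_ennreal prod.delta)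
  qed
  also have "\<dots> = (\<Prod>b\<in>Basis. \<integral>\<^sup>+u. h b u \<partial>lborel)"
    by (rule nn_integral_lborel_prod) simp_all
  also have "\<dots> = (\<integral>\<^sup>+u. h b0 u \<partial>lborel)"
    using b0 h1 by (subst prod.remove[of _ b0]) (auto intro!: prod.neutral)
  finally show ?thesis by (simp add: h_def)
qed

section \<open>The L1 distance between two normal densities\<close>

text \<open>
  The \<open>L\<^sub>1\<close> distance between two normal densities with covariance \<open>v I\<close> whose means are \<open>b\<close> apart.
  It is twice the mass that \<open>N(0, v)\<close> gives to \<open>[- b / 2, b / 2]\<close>.
\<close>

definition normal_L1_distance :: "real \<Rightarrow> real \<Rightarrow> real" where
  "normal_L1_distance v b = 4 * integral {0..b / 2} (normal_density 0 (sqrt v))"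

lemma continuous_on_normal_density: "continuous_on A (normal_density \<mu> \<sigma>)"
  unfolding normal_density_def by (cases "\<sigma> = 0") (auto intro!: continuous_intros)

lemma normal_density_even: "normal_density 0 \<sigma> (- u) = normal_density 0 \<sigma> u"
  by (simp add: normal_density_def)

lemma DERIV_normal_L1_distance:
  assumes "0 < x"
  shows "(normal_L1_distance v has_real_derivative 2 * normal_density 0 (sqrt v) (x / 2)) (at x)"
proof -
  have "((\<lambda>y. integral {0..y} (normal_density 0 (sqrt v))) has_real_derivative normal_density 0 (sqrt v) (x / 2))
      (at (x / 2) within {0..x})"
    using assms by (intro integral_has_real_derivative continuous_on_normal_density) auto
  also have "at (x / 2) within {0..x} = at (x / 2)"
    using assms by (intro at_within_interior) auto
  finally have "((\<lambda>y. integral {0..y} (normal_density 0 (sqrt v))) has_real_derivative normal_density 0 (sqrt v) (x / 2))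
      (at (x / 2))" .
  from DERIV_chain2[where g = "\<lambda>x. x / 2" and x = x and s = UNIV and Db = "1 / 2", OF this]
  have "((\<lambda>y. integral {0..y / 2} (normal_density 0 (sqrt v))) has_real_derivative
      normal_density 0 (sqrt v) (x / 2) * (1 / 2)) (at x)"
    using DERIV_cdivide[OF DERIV_ident, of 2 x UNIV] by simp
  from DERIV_cmult[OF this, of 4] show ?thesis
    unfolding normal_L1_distance_def by simp
qed

lemma continuous_on_normal_L1_distance: "continuous_on {0..b} (normal_L1_distance v)"
proof -
  have "continuous_on {0..b / 2} (\<lambda>y. integral {0..y} (normal_density 0 (sqrt v)))"
    by (intro indefinite_integral_continuous_1 integrable_continuous_real continuous_on_normal_density)
  then have "continuous_on {0..b} ((\<lambda>y. integral {0..y} (normal_density 0 (sqrt v))) \<circ> (\<lambda>y. y / 2))"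
    by (intro continuous_on_compose) (auto intro!: continuous_intros elim!: continuous_on_subset)
  then show ?thesis
    unfolding normal_L1_distance_def by (auto simp: o_def intro!: continuous_intros)
qed

lemma normal_density_div_strict_antimono:
  assumes "0 < v" "0 < x" "x < y"
  shows "normal_density 0 (sqrt v) (y / 2) / y < normal_density 0 (sqrt v) (x / 2) / x"
proof -
  have "x\<^sup>2 \<le> y\<^sup>2" using assms by (intro power_mono) auto
  then have "normal_density 0 (sqrt v) (y / 2) \<le> normal_density 0 (sqrt v) (x / 2)"
    using assms by (simp add: normal_density_def power_divide field_simps)
  moreover have "0 < normal_density 0 (sqrt v) (x / 2)"
    using assms by (intro normal_density_pos) simp
  ultimately have "normal_density 0 (sqrt v) (y / 2) * x < normal_density 0 (sqrt v) (x / 2) * y"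
    using assms by (intro mult_le_less_imp_less) (auto simp: normal_density_pos)
  then show ?thesis using assms by (simp add: field_simps)
qed

text \<open>
  The distance is a strictly concave function of \<open>b\<^sup>2\<close>, and this is its tangent inequality:
  the derivative with respect to \<open>b\<^sup>2\<close> is \<open>\<phi> (b / 2) / b\<close>, which decreases strictly.  So the difference \<open>K\<close> of the two sides
  decreases before \<open>a\<close> and increases after it.
\<close>

lemma normal_L1_distance_tangent_strict:
  assumes v: "0 < v" and a: "0 < a" and b: "0 \<le> b" and ab: "a \<noteq> b"
  shows "normal_L1_distance v b
    < normal_L1_distance v a + normal_density 0 (sqrt v) (a / 2) / a * (b\<^sup>2 - a\<^sup>2)"
proof -
  define c where "c = normal_density 0 (sqrt v) (a / 2) / a"
  define K where "K = (\<lambda>x. c * x\<^sup>2 - normal_L1_distance v x)"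
  have D: "(K has_real_derivative 2 * x * (c - normal_density 0 (sqrt v) (x / 2) / x)) (at x)" if "0 < x" for x
    unfolding K_def using that
    by (auto intro!: derivative_eq_intros DERIV_normal_L1_distance simp: field_simps)
  have cont: "continuous_on {s..t} K" if "0 \<le> s" for s t
    unfolding K_def using that
    by (intro continuous_intros continuous_on_subset[OF continuous_on_normal_L1_distance[of t]]) auto
  have "K a < K b"
  proof (cases "a < b")
    case True
    then show ?thesis
    proof (rule DERIV_pos_imp_increasing_open)
      fix x assume x: "a < x" "x < b"
      have "0 < 2 * x * (c - normal_density 0 (sqrt v) (x / 2) / x)"
        using normal_density_div_strict_antimono[OF v a x(1)] a x by (simp add: c_def)
      then show "\<exists>y. (K has_real_derivative y) (at x) \<and> 0 < y"
        using D[of x] a x by auto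
    qed (use a cont in auto)
  next
    case False
    with ab have "b < a" by simp
    then show ?thesis
    proof (rule DERIV_neg_imp_decreasing_open)
      fix x assume x: "b < x" "x < a"
      have "2 * x * (c - normal_density 0 (sqrt v) (x / 2) / x) < 0"
        using normal_density_div_strict_antimono[OF v _ x(2)] b x
        by (simp add: c_def mult_less_0_iff)
      then show "\<exists>y. (K has_real_derivative y) (at x) \<and> y < 0"
        using D[of x] b x by auto
    qed (use b cont in auto)
  qed
  then show ?thesis unfolding c_def[symmetric] by (simp add: K_def algebra_simps)
qed

lemma normal_L1_distance_nonneg: "0 \<le> normal_L1_distance v b"
  unfolding normal_L1_distance_def
  by (intro mult_nonneg_nonneg Henstock_Kurzweil_Integration.integral_nonneg
      integrable_continuous_real continuous_on_normal_density) auto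

lemma nn_integral_normal_density_Icc:
  "(\<integral>\<^sup>+u. indicator {0..b / 2} u * ennreal (normal_density 0 (sqrt v) u) \<partial>lborel)
    = ennreal (normal_L1_distance v b / 4)" (is "?l = _")
proof -
  have i: "set_integrable lborel {0..b / 2} (normal_density 0 (sqrt v))"
    by (intro borel_integrable_atLeastAtMost' continuous_on_normal_density)
  have "?l = (\<integral>\<^sup>+u. ennreal (indicator {0..b / 2} u *\<^sub>R normal_density 0 (sqrt v) u) \<partial>lborel)"
    by (intro nn_integral_cong) (auto simp: indicator_def)
  also have "\<dots> = ennreal (LINT u:{0..b / 2}|lborel. normal_density 0 (sqrt v) u)"
    using i unfolding set_integrable_def set_lebesgue_integral_def
    by (intro nn_integral_eq_integral) auto
  also have "\<dots> = ennreal (normal_L1_distance v b / 4)"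
    using set_borel_integral_eq_integral(2)[OF i] by (simp add: normal_L1_distance_def)
  finally show ?thesis .
qed

text \<open>
  The density centred at \<open>0\<close> is the larger one exactly on the half-space of points closer to \<open>0\<close> than
  to \<open>d\<close>.  Since \<open>\<bar>s - t\<bar> + 2 min s t = s + t\<close>, the distance is two minus twice the overlap, and the overlap consists of two tails of the
  marginal along \<open>d\<close>.
\<close>

lemma nn_integral_normal_kernel_shift:
  fixes d :: "real ^ 'p"
  assumes v: "0 < v"
  shows "(\<integral>\<^sup>+y. ennreal \<bar>normal_kernel v y - normal_kernel v (y - d)\<bar> \<partial>lborel)
    = ennreal (normal_L1_distance v (norm d))"
proof (cases "d = 0")
  case True
  then show ?thesis by (simp add: normal_L1_distance_def)
next
  case False
  define \<delta> where "\<delta> = norm d"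
  define e where "e = d /\<^sub>R \<delta>"
  have \<delta>: "0 < \<delta>" and e: "norm e = 1" and d: "d = \<delta> *\<^sub>R e" and ee: "e \<bullet> e = 1"
    using False by (auto simp: \<delta>_def e_def dot_square_norm power2_eq_square)
  let ?n = "\<lambda>y :: real ^ 'p. ennreal (normal_kernel v y)"
  let ?g = "\<lambda>u. ennreal (normal_density 0 (sqrt v) u)"
  define T where "T A = (\<integral>\<^sup>+u. indicator A u * ?g u \<partial>lborel)" for A
  have T: "(\<integral>\<^sup>+y. indicator A (y \<bullet> e) * ?n y \<partial>lborel) = T A" if [measurable]: "A \<in> sets borel" for A
    unfolding T_def using v e by (rule nn_integral_normal_kernel_marginal) simp
  have T_Un: "T (A \<union> B) = T A + T B" if [measurable]: "A \<in> sets borel" "B \<in> sets borel" and "A \<inter> B = {}" for A B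
    unfolding T_def using that(3)
    by (subst nn_integral_add[symmetric]) (auto intro!: nn_integral_cong simp: indicator_def)
  have T_UNIV: "T UNIV = 1"
    unfolding T_def using v by (simp add: nn_integral_eq_integral)
  \<comment> \<open>The overlap of the two densities.\<close>
  define R where "R = T {\<delta> / 2<..} + T {..- \<delta> / 2}"
  have split: "1 = R + T {- \<delta> / 2<..\<delta> / 2}"
  proof -
    have "UNIV = {\<delta> / 2<..} \<union> ({..- \<delta> / 2} \<union> {- \<delta> / 2<..\<delta> / 2})" using \<delta> by auto
    then show ?thesis unfolding R_def
      using T_UNIV \<delta> by (subst (asm) \<open>UNIV = _\<close>, subst (asm) T_Un, (auto)[3], subst (asm) T_Un) (auto simp: add.assoc)
  qed
  have order: "normal_kernel v (y - d) \<le> normal_kernel v y \<longleftrightarrow> y \<bullet> e \<le> \<delta> / 2" for y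
  proof -
    have "(norm (y - d))\<^sup>2 = (norm y)\<^sup>2 - 2 * \<delta> * (y \<bullet> e) + \<delta>\<^sup>2"
      unfolding power2_norm_eq_inner d
      by (simp add: inner_diff_left inner_diff_right inner_commute[of e y] ee algebra_simps power2_eq_square[of \<delta>]
          del: dot_square_norm)
    moreover have "normal_kernel v (y - d) \<le> normal_kernel v y \<longleftrightarrow> (norm y)\<^sup>2 \<le> (norm (y - d))\<^sup>2"
      using v by (simp add: normal_kernel_le_iff)
    moreover have "2 * \<delta> * (y \<bullet> e) \<le> \<delta>\<^sup>2 \<longleftrightarrow> y \<bullet> e \<le> \<delta> / 2"
      using \<delta> by (simp add: power2_eq_square field_simps)
    ultimately show ?thesis by linarith
  qed
  have "(\<integral>\<^sup>+y. ennreal \<bar>normal_kernel v y - normal_kernel v (y - d)\<bar> \<partial>lborel) + 2 * R = 2"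
  proof -
    have *: "ennreal \<bar>normal_kernel v y - normal_kernel v (y - d)\<bar>
        + 2 * (indicator {\<delta> / 2<..} (y \<bullet> e) * ?n y + indicator {..- \<delta> / 2} ((y - d) \<bullet> e) * ?n (y - d))
        = ?n y + ?n (y - d)" for y
    proof (cases "y \<bullet> e \<le> \<delta> / 2")
      case True
      then have "(y - d) \<bullet> e \<le> - \<delta> / 2" by (simp add: d inner_diff_left ee)
      with True order[of y] show ?thesis
        by (simp add: ennreal_plus[symmetric] ennreal_mult[symmetric]
            ennreal_numeral[symmetric] del: ennreal_plus ennreal_numeral)
    next
      case False
      then have "\<not> (y - d) \<bullet> e \<le> - \<delta> / 2" by (simp add: d inner_diff_left ee)
      with False order[of y] show ?thesis
        by (simp add: ennreal_plus[symmetric] ennreal_mult[symmetric]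
            ennreal_numeral[symmetric] del: ennreal_plus ennreal_numeral)
    qed
    have s: "(\<integral>\<^sup>+y. f (y - d) \<partial>lborel) = (\<integral>\<^sup>+y. f y \<partial>lborel)"
      if "f \<in> borel_measurable borel" for f :: "real ^ 'p \<Rightarrow> ennreal"
      using nn_integral_translate[OF that, of "- d"] by simp
    have "(\<integral>\<^sup>+y. ennreal \<bar>normal_kernel v y - normal_kernel v (y - d)\<bar> \<partial>lborel) + 2 * R
      = (\<integral>\<^sup>+y. ?n y + ?n (y - d) \<partial>lborel)"
      unfolding *[symmetric] R_def
      using s[of "\<lambda>y. indicator {..- \<delta> / 2} (y \<bullet> e) * ?n y"]
      by (simp add: nn_integral_add nn_integral_cmult T)
    also have "\<dots> = 2"
      using s[of ?n] v by (simp add: nn_integral_add nn_integral_normal_kernel)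
    finally show ?thesis .
  qed
  moreover have "2 * T {- \<delta> / 2<..\<delta> / 2} + 2 * R = 2"
    using split by (metis add.commute distrib_left mult.right_neutral)
  moreover have "2 * R \<noteq> \<top>"
  proof -
    have "R \<noteq> \<top>" using split by (metis ennreal_add_eq_top ennreal_one_neq_top)
    then show ?thesis by (simp add: ennreal_mult_eq_top_iff)
  qed
  ultimately have D: "(\<integral>\<^sup>+y. ennreal \<bar>normal_kernel v y - normal_kernel v (y - d)\<bar> \<partial>lborel)
      = 2 * T {- \<delta> / 2<..\<delta> / 2}"
    by (metis ennreal_add_left_cancel add.commute infinity_ennreal_def)
  have "T {- \<delta> / 2<..\<delta> / 2} = T {0..\<delta> / 2} + T {- \<delta> / 2<..<0}"
    using \<delta> by (subst T_Un[symmetric]) (auto intro!: arg_cong[of _ _ T])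
  also have "T {- \<delta> / 2<..<0} = (\<integral>\<^sup>+u. indicator {- \<delta> / 2<..<0} (0 - u) * ?g (0 - u) \<partial>lborel)"
    unfolding T_def by (rule nn_integral_reflect[symmetric]) simp
  also have "\<dots> = T {0..\<delta> / 2}"
    unfolding T_def
  proof (rule nn_integral_cong_AE)
    show "AE u in lborel. indicator {- \<delta> / 2<..<0} (0 - u) * ?g (0 - u) = indicator {0..\<delta> / 2} u * ?g u"
      using AE_lborel_singleton[of 0] AE_lborel_singleton[of "\<delta> / 2"]
      by eventually_elim (auto simp: normal_density_even indicator_def)
  qed
  also have "T {0..\<delta> / 2} = ennreal (normal_L1_distance v \<delta> / 4)"
    unfolding T_def by (rule nn_integral_normal_density_Icc)
  finally have "2 * T {- \<delta> / 2<..\<delta> / 2} = ennreal (normal_L1_distance v \<delta>)"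
    using normal_L1_distance_nonneg[of v \<delta>]
    by (simp add: ennreal_plus[symmetric] ennreal_mult[symmetric]
            ennreal_numeral[symmetric] del: ennreal_plus ennreal_numeral)
  then show ?thesis using D by (simp add: \<delta>_def)
qed

section \<open>L1 loss as a concave function of the squared distance\<close>

lemma mixing_lawD:
  assumes "mixing_law p G"
  shows "prob_space G" "sets G = sets borel" "AE v in G. 0 < v" "space G = UNIV"
    "integrable G (\<lambda>v. v powr (- (real p / 2)))"
  using assms real_distribution.space_eq_univ[of G]
  by (auto simp: mixing_law_def real_distribution_def real_distribution_axioms_def)

lemma mixing_law_measurable:
  assumes "mixing_law p G"
  shows "measurable G N = measurable borel N" "measurable N G = measurable N borel"
  by (rule measurable_cong_sets; simp add: mixing_lawD(2)[OF assms])+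

lemma integrable_normal_kernel_mixing:
  fixes s :: "real ^ 'p"
  assumes "mixing_law CARD('p) G"
  shows "integrable G (\<lambda>v. normal_kernel v s)"
proof (rule Bochner_Integration.integrable_bound)
  show "integrable G (\<lambda>v. (2 * pi) powr (- (real CARD('p) / 2)) * v powr (- (real CARD('p) / 2)))"
    using mixing_lawD(5)[OF assms] by simp
  show "(\<lambda>v. normal_kernel v s) \<in> borel_measurable G"
    by (simp add: mixing_law_measurable[OF assms])
  show "AE v in G. norm (normal_kernel v s)
      \<le> norm ((2 * pi) powr (- (real CARD('p) / 2)) * v powr (- (real CARD('p) / 2)))"
    using mixing_lawD(3)[OF assms]
    by eventually_elim (simp add: normal_kernel_def abs_mult powr_mult mult_left_le)
qed

lemma ennreal_SN:
  fixes s :: "real ^ 'p"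
  assumes "mixing_law CARD('p) G"
  shows "ennreal (SN G s) = (\<integral>\<^sup>+v. ennreal (normal_kernel v s) \<partial>G)"
  unfolding SN_def using integrable_normal_kernel_mixing[OF assms]
  by (subst nn_integral_eq_integral) auto

lemma SN_pos:
  fixes s :: "real ^ 'p"
  assumes G: "mixing_law CARD('p) G"
  shows "0 < SN G s"
proof -
  interpret prob_space G using G by (rule mixing_lawD)
  have "0 < (\<integral>v. normal_kernel v s \<partial>G)"
    using mixing_lawD(3)[OF G] integrable_normal_kernel_mixing[OF G]
    by (subst integral_less_AE_space[of "\<lambda>_. 0", simplified]) (auto simp: normal_kernel_pos emeasure_space_1 elim!: eventually_mono)
  then show ?thesis by (simp add: SN_def)
qed

lemma measurable_SN [measurable]:
  assumes G: "mixing_law CARD('p) G"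
  shows "(SN G :: real ^ 'p \<Rightarrow> real) \<in> borel_measurable borel"
proof -
  interpret prob_space G using G by (rule mixing_lawD)
  have [measurable_cong]: "sets G = sets borel" using G by (rule mixing_lawD)
  show ?thesis unfolding SN_def[abs_def] by measurable
qed

lemma nn_integral_SN:
  assumes G: "mixing_law CARD('p) G"
  shows "(\<integral>\<^sup>+s. ennreal (SN G (s :: real ^ 'p)) \<partial>lborel) = 1"
proof -
  interpret prob_space G using G by (rule mixing_lawD)
  have [measurable_cong]: "sets G = sets borel" using G by (rule mixing_lawD)
  interpret pair_sigma_finite G "lborel :: (real ^ 'p) measure" ..
  have "(\<integral>\<^sup>+s. ennreal (SN G (s :: real ^ 'p)) \<partial>lborel)
      = (\<integral>\<^sup>+v. (\<integral>\<^sup>+s. ennreal (normal_kernel v (s :: real ^ 'p)) \<partial>lborel) \<partial>G)"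
    unfolding ennreal_SN[OF G] by (rule Fubini') simp
  also have "\<dots> = (\<integral>\<^sup>+v. 1 \<partial>G)"
    using mixing_lawD(3)[OF G] by (intro nn_integral_cong_AE) (auto simp: nn_integral_normal_kernel elim!: eventually_mono)
  finally show ?thesis by (simp add: emeasure_space_1)
qed

definition mixed_L1_distance :: "real measure \<Rightarrow> real \<Rightarrow> ennreal" where
  "mixed_L1_distance H b = (\<integral>\<^sup>+w. ennreal (normal_L1_distance w b) \<partial>H)"

text \<open>
  Derivative of \<^term>\<open>mixed_L1_distance H\<close> with respect to the squared distance.
\<close>

definition mixed_slope :: "real measure \<Rightarrow> real \<Rightarrow> ennreal" where
  "mixed_slope H a = (\<integral>\<^sup>+w. ennreal (normal_density 0 (sqrt w) (a / 2) / a) \<partial>H)"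

lemma measurable_normal_density_variance [measurable]:
  "(\<lambda>(v, u). normal_density 0 (sqrt v) u) \<in> borel_measurable (borel \<Otimes>\<^sub>M borel)"
  unfolding normal_density_def case_prod_beta by measurable

lemma measurable_normal_L1_distance [measurable]:
  "(\<lambda>(v, b). normal_L1_distance v b) \<in> borel_measurable (borel \<Otimes>\<^sub>M borel)"
proof -
  have "normal_L1_distance v b
      = enn2real (4 * (\<integral>\<^sup>+u. indicator {0..b / 2} u * ennreal (normal_density 0 (sqrt v) u) \<partial>lborel))" for v b
    unfolding nn_integral_normal_density_Icc using normal_L1_distance_nonneg[of v b]
    by (simp add: enn2real_mult)
  moreover have "(\<lambda>(v, b). enn2real (4 * (\<integral>\<^sup>+u. (if 0 \<le> u \<and> u \<le> b / 2 then 1 else 0) * ennreal (normal_density 0 (sqrt v) u) \<partial>lborel)))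
      \<in> borel_measurable (borel \<Otimes>\<^sub>M borel)"
    by measurable
  ultimately show ?thesis
    by (simp add: indicator_def of_bool_def)
qed

lemma measurable_mixed_distance_slope [measurable]:
  assumes G: "mixing_law p G"
  shows "mixed_L1_distance G \<in> borel_measurable borel" "mixed_slope G \<in> borel_measurable borel"
proof -
  interpret prob_space G using G by (rule mixing_lawD)
  have [measurable_cong]: "sets G = sets borel" using G by (rule mixing_lawD)
  show "mixed_L1_distance G \<in> borel_measurable borel" "mixed_slope G \<in> borel_measurable borel"
    unfolding mixed_L1_distance_def[abs_def] mixed_slope_def[abs_def] by measurable
qed

text \<open>
  Every component of the mixture is decreasing in the norm, so the differences of the components all have the
  same sign and no cancellation takes place.  Hence the \<open>L\<^sub>1\<close> distance of the mixtures is the mixture of the \<open>L\<^sub>1\<close> distances.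
\<close>

lemma abs_SN_diff:
  fixes y z :: "real ^ 'p"
  assumes H: "mixing_law CARD('p) H"
  shows "ennreal \<bar>SN H y - SN H z\<bar> = (\<integral>\<^sup>+w. ennreal \<bar>normal_kernel w y - normal_kernel w z\<bar> \<partial>H)"
proof -
  have *: "ennreal \<bar>SN H y - SN H z\<bar> = (\<integral>\<^sup>+w. ennreal \<bar>normal_kernel w y - normal_kernel w z\<bar> \<partial>H)"
    if le: "norm y \<le> norm z" for y z :: "real ^ 'p"
  proof -
    have int: "integrable H (\<lambda>w. normal_kernel w y - normal_kernel w z)"
      using integrable_normal_kernel_mixing[OF H] by (intro Bochner_Integration.integrable_diff)
    have nn: "AE w in H. 0 \<le> normal_kernel w y - normal_kernel w z"
      using mixing_lawD(3)[OF H] le by (auto simp: normal_kernel_le_iff elim!: eventually_mono)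
    have eq: "SN H y - SN H z = (\<integral>w. normal_kernel w y - normal_kernel w z \<partial>H)"
      unfolding SN_def using integrable_normal_kernel_mixing[OF H] by simp
    then have "ennreal \<bar>SN H y - SN H z\<bar> = ennreal (\<integral>w. normal_kernel w y - normal_kernel w z \<partial>H)"
      using integral_nonneg_AE[OF nn] by simp
    also have "\<dots> = (\<integral>\<^sup>+w. ennreal (normal_kernel w y - normal_kernel w z) \<partial>H)"
      using nn_integral_eq_integral[OF int nn] by simp
    also have "\<dots> = (\<integral>\<^sup>+w. ennreal \<bar>normal_kernel w y - normal_kernel w z\<bar> \<partial>H)"
      using nn by (intro nn_integral_cong_AE) (auto elim!: eventually_mono)
    finally show ?thesis .
  qed
  show ?thesis
    using *[of y z] *[of z y] by (cases "norm y \<le> norm z") (simp_all add: abs_minus_commute)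
qed

lemma L1_loss_plug_in:
  fixes \<mu> :: "real ^ 'p"
  assumes H: "mixing_law CARD('p) H" and q: "\<And>s :: real ^ 'p. q ((norm s)\<^sup>2) = SN H s"
  shows "L1_loss q \<mu> (plug_in q m x) = mixed_L1_distance H (norm (m x - \<mu>))"
proof -
  interpret prob_space H using H by (rule mixing_lawD)
  have [measurable_cong]: "sets H = sets borel" using H by (rule mixing_lawD)
  interpret pair_sigma_finite H "lborel :: (real ^ 'p) measure" ..
  let ?d = "m x - \<mu>"
  have "L1_loss q \<mu> (plug_in q m x)
      = (\<integral>\<^sup>+y. (\<integral>\<^sup>+w. ennreal \<bar>normal_kernel w (y - \<mu>) - normal_kernel w (y - m x)\<bar> \<partial>H) \<partial>lborel)"
    by (simp add: L1_loss_def plug_in_def q abs_SN_diff[OF H])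
  also have "\<dots> = (\<integral>\<^sup>+w. (\<integral>\<^sup>+y. ennreal \<bar>normal_kernel w (y - \<mu>) - normal_kernel w (y - m x)\<bar> \<partial>lborel) \<partial>H)"
    by (rule Fubini') simp
  also have "\<dots> = (\<integral>\<^sup>+w. ennreal (normal_L1_distance w (norm ?d)) \<partial>H)"
  proof (rule nn_integral_cong_AE)
    show "AE w in H. (\<integral>\<^sup>+y. ennreal \<bar>normal_kernel w (y - \<mu>) - normal_kernel w (y - m x)\<bar> \<partial>lborel)
        = ennreal (normal_L1_distance w (norm ?d))"
      using mixing_lawD(3)[OF H]
    proof eventually_elim
      case (elim w)
      have "(\<integral>\<^sup>+y. ennreal \<bar>normal_kernel w (y - \<mu>) - normal_kernel w (y - m x)\<bar> \<partial>lborel)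
        = (\<integral>\<^sup>+y. ennreal \<bar>normal_kernel w (y + \<mu> - \<mu>) - normal_kernel w (y + \<mu> - m x)\<bar> \<partial>lborel)"
        by (rule nn_integral_translate[symmetric]) simp
      also have "\<dots> = (\<integral>\<^sup>+y. ennreal \<bar>normal_kernel w y - normal_kernel w (y - ?d)\<bar> \<partial>lborel)"
        by (simp add: algebra_simps)
      finally show ?case using nn_integral_normal_kernel_shift[OF elim, of ?d] by simp
    qed
  qed
  finally show ?thesis by (simp add: mixed_L1_distance_def)
qed

lemma normal_L1_distance_le_2:
  assumes "0 < v"
  shows "normal_L1_distance v b \<le> 2"
proof -
  have "normal_L1_distance v b / 4 + normal_L1_distance v b / 4 \<le> 1"
  proof -
    have *: "(\<integral>\<^sup>+u. indicator {0..b / 2} u * ennreal (normal_density 0 (sqrt v) u) \<partial>lborel)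
       = (\<integral>\<^sup>+u. indicator {0..b / 2} (0 - u) * ennreal (normal_density 0 (sqrt v) (0 - u)) \<partial>lborel)"
      by (rule nn_integral_reflect[symmetric]) simp
    have "ennreal (normal_L1_distance v b / 4) + ennreal (normal_L1_distance v b / 4)
       = (\<integral>\<^sup>+u. indicator {0..b / 2} u * ennreal (normal_density 0 (sqrt v) u)
           + indicator {0..b / 2} (0 - u) * ennreal (normal_density 0 (sqrt v) (0 - u)) \<partial>lborel)"
      by (subst nn_integral_add) (simp_all only: *[symmetric] nn_integral_normal_density_Icc, simp_all)
    also have "\<dots> \<le> (\<integral>\<^sup>+u. ennreal (normal_density 0 (sqrt v) u) \<partial>lborel)"
      using AE_lborel_singleton[of 0]
      by (intro nn_integral_mono_AE) (auto simp: indicator_def normal_density_even elim!: eventually_mono)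
    also have "\<dots> = 1" using assms by (simp add: nn_integral_eq_integral)
    finally show ?thesis using normal_L1_distance_nonneg[of v b]
      by (simp add: ennreal_plus[symmetric] ennreal_1[symmetric] del: ennreal_plus ennreal_1)
  qed
  then show ?thesis by simp
qed

lemma mixed_L1_distance_le_2:
  assumes H: "mixing_law p H"
  shows "mixed_L1_distance H b \<le> 2"
proof -
  interpret prob_space H using H by (rule mixing_lawD)
  have "mixed_L1_distance H b \<le> (\<integral>\<^sup>+w. 2 \<partial>H)"
    unfolding mixed_L1_distance_def using mixing_lawD(3)[OF H]
    by (intro nn_integral_mono_AE)
       (auto simp: normal_L1_distance_le_2 ennreal_numeral[symmetric] simp del: ennreal_numeral elim!: eventually_mono)
  then show ?thesis by (simp add: emeasure_space_1)
qed

lemma normal_slope_bound: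
  assumes v: "0 < v" and a: "0 < a"
  shows "normal_density 0 (sqrt v) (a / 2) / a * a\<^sup>2 \<le> 1"
proof -
  \<comment> \<open>In units of the standard deviation the claim is \<open>x exp (- x\<^sup>2 / 8) \<le> \<surd>(2 \<pi>)\<close>.\<close>
  define x where "x = a / sqrt v"
  have x: "0 < x" using v a by (simp add: x_def)
  have "x \<le> 2 * (1 + x\<^sup>2 / 8)" using zero_le_power2[of "x - 2"] by (simp add: power2_eq_square algebra_simps)
  also have "\<dots> \<le> 2 * exp (x\<^sup>2 / 8)"
    by (intro mult_left_mono exp_ge_add_one_self) simp
  finally have "x * exp (- (x\<^sup>2 / 8)) \<le> 2"
    by (simp add: exp_minus field_simps)
  moreover have "2 \<le> sqrt (2 * pi)"
    using pi_gt3 by (intro real_le_rsqrt) simp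
  ultimately have "x * exp (- (x\<^sup>2 / 8)) \<le> sqrt (2 * pi)" by simp
  moreover have "normal_density 0 (sqrt v) (a / 2) / a * a\<^sup>2 = x * exp (- (x\<^sup>2 / 8)) / sqrt (2 * pi)"
    using v a by (simp add: normal_density_def x_def real_sqrt_mult power_divide power2_eq_square field_simps)
  ultimately show ?thesis by (simp add: divide_le_eq_1)
qed

text \<open>
  The loss is concave and bounded, so its slope decays like the reciprocal of the squared distance.  This keeps the
  quadratic risk of the identity under the weight \<open>p\<^sup>*\<close> finite.
\<close>

lemma mixed_slope_bound:
  assumes H: "mixing_law p H" and a: "0 < a"
  shows "mixed_slope H a * ennreal (a\<^sup>2) \<le> 1"
proof -
  interpret prob_space H using H by (rule mixing_lawD)
  have [measurable_cong]: "sets H = sets borel" using H by (rule mixing_lawD)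
  have "mixed_slope H a * ennreal (a\<^sup>2) = (\<integral>\<^sup>+w. ennreal (normal_density 0 (sqrt w) (a / 2) / a * a\<^sup>2) \<partial>H)"
    unfolding mixed_slope_def using a
    by (subst nn_integral_multc[symmetric]) (simp_all add: ennreal_mult[symmetric])
  also have "\<dots> \<le> (\<integral>\<^sup>+w. 1 \<partial>H)"
    using mixing_lawD(3)[OF H] normal_slope_bound[OF _ a]
    by (intro nn_integral_mono_AE) (auto elim!: eventually_mono)
  finally show ?thesis by (simp add: emeasure_space_1)
qed

lemma mixed_L1_distance_tangent:
  assumes H: "mixing_law p H" and a: "0 < a" and b: "0 \<le> b"
  shows "mixed_L1_distance H b + mixed_slope H a * ennreal (a\<^sup>2)
      \<le> mixed_L1_distance H a + mixed_slope H a * ennreal (b\<^sup>2)" (is "?L \<le> ?R")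
    and "a \<noteq> b \<Longrightarrow> mixed_L1_distance H b + mixed_slope H a * ennreal (a\<^sup>2)
      < mixed_L1_distance H a + mixed_slope H a * ennreal (b\<^sup>2)"
proof -
  interpret prob_space H using H by (rule mixing_lawD)
  have [measurable_cong]: "sets H = sets borel" using H by (rule mixing_lawD)
  let ?f = "\<lambda>b c w. ennreal (normal_L1_distance w b + normal_density 0 (sqrt w) (a / 2) / a * c\<^sup>2)"
  have eq: "mixed_L1_distance H b + mixed_slope H a * ennreal (c\<^sup>2) = (\<integral>\<^sup>+w. ?f b c w \<partial>H)" for b c
    unfolding mixed_slope_def mixed_L1_distance_def using a normal_L1_distance_nonneg
    by (subst nn_integral_multc[symmetric], simp, subst nn_integral_add[symmetric])
       (simp_all add: ennreal_mult[symmetric] ennreal_plus[symmetric] del: ennreal_plus)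
  \<comment> \<open>Moving the negative part of the tangent to the left-hand side makes all terms nonnegative.\<close>
  have strict: "AE w in H. ?f b a w < ?f a b w" if "a \<noteq> b"
    using mixing_lawD(3)[OF H]
  proof eventually_elim
    case (elim w)
    have "0 \<le> normal_L1_distance w b + normal_density 0 (sqrt w) (a / 2) / a * a\<^sup>2"
      using normal_L1_distance_nonneg a by simp
    moreover have "normal_L1_distance w b + normal_density 0 (sqrt w) (a / 2) / a * a\<^sup>2
        < normal_L1_distance w a + normal_density 0 (sqrt w) (a / 2) / a * b\<^sup>2"
      using normal_L1_distance_tangent_strict[OF elim a b that] by (simp add: right_diff_distrib)
    ultimately show ?case by (intro ennreal_lessI) linarith+
  qed
  show "?L < ?R" if "a \<noteq> b"
    unfolding eq
  proof (rule nn_integral_less)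
    have "mixed_L1_distance H b + mixed_slope H a * ennreal (a\<^sup>2) \<le> 2 + 1"
      by (intro add_mono mixed_L1_distance_le_2[OF H] mixed_slope_bound[OF H a])
    then show "(\<integral>\<^sup>+w. ?f b a w \<partial>H) \<noteq> \<infinity>"
      unfolding eq by (auto simp: top_unique)
    show "AE w in H. ?f b a w \<le> ?f a b w"
      using strict[OF that] by (auto elim!: eventually_mono)
    show "\<not> (AE w in H. ?f a b w \<le> ?f b a w)"
    proof
      assume "AE w in H. ?f a b w \<le> ?f b a w"
      with strict[OF that] have "AE w in H. False" by eventually_elim auto
      then show False by simp
    qed
  qed simp_all
  then show "?L \<le> ?R" by (cases "a = b") auto
qed

section \<open>The law of Z\<close>

text \<open>
  Where the law of \<open>Z\<close> comes from: in a product of the two Gaussian factors the exponents add up to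
  \<open>- \<parallel>s\<parallel>\<^sup>2 / (2 z)\<close> with \<open>1 / z = 1 / v + 1 / (4 w)\<close>, and \<^const>\<open>tau_weight\<close> collects the normalizing factors that remain.
\<close>

lemma tau_weight_identity:
  fixes s :: "real ^ 'p"
  assumes v: "0 < v" and w: "0 < w" and s: "s \<noteq> 0"
  shows "normal_kernel v s * (normal_density 0 (sqrt w) (norm s / 2) / norm s)
    = 2 ^ CARD('p) / sqrt (2 * pi) * tau_weight CARD('p) (v, w)
        * (normal_kernel (4 * v * w / (v + 4 * w)) s / norm s)"
proof -
  define q where "q = real CARD('p) / 2"
  have vw: "0 < v + 4 * w" using v w by simp
  have e: "exp (- ((norm s)\<^sup>2 / (2 * v))) * exp (- ((norm s / 2)\<^sup>2 / (2 * w)))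
      = exp (- ((norm s)\<^sup>2 / (2 * (4 * v * w / (v + 4 * w)))))"
  proof -
    have "(norm s)\<^sup>2 / (2 * v) + (norm s / 2)\<^sup>2 / (2 * w) = (norm s)\<^sup>2 / (2 * (4 * v * w / (v + 4 * w)))"
      using v w by (simp add: power_divide field_simps)
    then show ?thesis by (simp add: exp_add[symmetric])
  qed
  have four: "(4 :: real) powr q = 2 ^ CARD('p)"
  proof -
    have "(4 :: real) powr q = (2 powr 2) powr q" by simp
    also have "\<dots> = 2 powr real CARD('p)" by (simp only: powr_powr) (simp add: q_def)
    finally show ?thesis by (simp add: powr_realpow)
  qed
  have ww: "w powr (q - 1 / 2) = w powr q / sqrt w"
    using w by (simp add: powr_diff powr_half_sqrt)
  have c: "(2 * pi * v) powr (- q) * (1 / sqrt (2 * pi * w))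
     = 2 ^ CARD('p) / sqrt (2 * pi) * (w powr (q - 1 / 2) / (v + 4 * w) powr q)
         * (2 * pi * (4 * v * w / (v + 4 * w))) powr (- q)"
    using v w vw powr_mult[of 2 4 q] unfolding ww four[symmetric]
    by (simp add: powr_minus powr_mult powr_divide real_sqrt_mult field_simps)
  have t: "tau_weight CARD('p) (v, w) = w powr (q - 1 / 2) / (v + 4 * w) powr q"
    by (simp add: tau_weight_def q_def diff_divide_distrib)
  have "normal_kernel v s * (normal_density 0 (sqrt w) (norm s / 2) / norm s)
      = ((2 * pi * v) powr (- q) * (1 / sqrt (2 * pi * w)))
        * (exp (- ((norm s)\<^sup>2 / (2 * v))) * exp (- ((norm s / 2)\<^sup>2 / (2 * w)))) / norm s"
    using w by (simp add: normal_kernel_def normal_density_def q_def)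
  also have "\<dots> = 2 ^ CARD('p) / sqrt (2 * pi) * tau_weight CARD('p) (v, w)
        * (normal_kernel (4 * v * w / (v + 4 * w)) s / norm s)"
    unfolding c e t by (simp add: normal_kernel_def q_def)
  finally show ?thesis .
qed

lemma measurable_tau_weight [measurable]:
  "tau_weight p \<in> borel_measurable (borel \<Otimes>\<^sub>M borel)"
  unfolding tau_weight_def case_prod_beta by measurable

lemma tau_weight_nonneg: "0 \<le> tau_weight p z"
  by (simp add: tau_weight_def case_prod_beta)

locale mixing_pair =
  fixes p :: nat and G H :: "real measure"
  assumes p: "0 < p" and G: "mixing_law p G" and H: "mixing_law p H"
begin

sublocale G: prob_space G using G by (rule mixing_lawD)
sublocale H: prob_space H using H by (rule mixing_lawD)
sublocale pair_prob_space G H ..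

lemma sets_G_H [measurable_cong]: "sets G = sets borel" "sets H = sets borel"
  using G H by (auto dest: mixing_lawD)

lemma AE_pair_pos: "AE z in G \<Otimes>\<^sub>M H. 0 < fst z \<and> 0 < snd z"
proof (rule AE_pair_measure)
  show "AE x in G. AE y in H. 0 < fst (x, y) \<and> 0 < snd (x, y)"
    using mixing_lawD(3)[OF G] mixing_lawD(3)[OF H] by (auto elim!: eventually_mono)
qed simp

text \<open>
  The weight is at most \<open>w\<^sup>-\<^sup>1\<^sup>/\<^sup>2 \<le> 1 + w\<^sup>-\<^sup>p\<^sup>/\<^sup>2\<close>, which the moment condition on \<open>H\<close> controls.
\<close>

lemma integrable_tau_weight: "integrable (G \<Otimes>\<^sub>M H) (tau_weight p)"
proof (rule Bochner_Integration.integrable_bound)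
  have i: "integrable H (\<lambda>w. 1 + w powr (- (real p / 2)))"
    using mixing_lawD(5)[OF H] by simp
  show "integrable (G \<Otimes>\<^sub>M H) (\<lambda>z. 1 + snd z powr (- (real p / 2)))"
  proof (rule integrableI_bounded)
    have "(\<integral>\<^sup>+z. ennreal (norm (1 + snd z powr (- (real p / 2)))) \<partial>(G \<Otimes>\<^sub>M H))
        = (\<integral>\<^sup>+v. \<integral>\<^sup>+w. ennreal (norm (1 + w powr (- (real p / 2)))) \<partial>H \<partial>G)"
      by (subst H.nn_integral_fst[symmetric]) simp_all
    also have "\<dots> < \<infinity>"
      using i by (simp add: G.emeasure_space_1 integrable_iff_bounded)
    finally show "(\<integral>\<^sup>+z. ennreal (norm (1 + snd z powr (- (real p / 2)))) \<partial>(G \<Otimes>\<^sub>M H)) < \<infinity>" .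
  qed simp
  show "AE z in G \<Otimes>\<^sub>M H. norm (tau_weight p z) \<le> norm (1 + snd z powr (- (real p / 2)))"
    using AE_pair_pos
  proof eventually_elim
    case (elim z)
    define w where "w = snd z"
    have w: "0 < w" using elim by (simp add: w_def)
    have "tau_weight p z = w powr ((real p - 1) / 2) / (fst z + 4 * w) powr (real p / 2)"
      by (simp add: tau_weight_def w_def case_prod_beta)
    also have "\<dots> \<le> w powr ((real p - 1) / 2) / w powr (real p / 2)"
      using elim w by (intro divide_left_mono powr_mono2 mult_pos_pos) (auto simp: w_def)
    also have "\<dots> = w powr (- 1 / 2)"
      using w by (simp add: powr_diff[symmetric] diff_divide_distrib)
    also have "\<dots> \<le> 1 + w powr (- (real p / 2))"
    proof (cases "w \<le> 1")
      case True
      have "w powr (- 1 / 2) \<le> w powr (- (real p / 2))"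
        using w True p by (intro powr_mono') auto
      then show ?thesis by simp
    next
      case False
      then have "w powr (- 1 / 2) \<le> w powr 0" by (intro powr_mono) auto
      with w show ?thesis by (simp add: add_increasing2)
    qed
    finally show ?case using tau_weight_nonneg[of p z] by (simp add: w_def)
  qed
qed simp

definition tau_mass :: real where
  "tau_mass = (\<integral>w. tau_weight p w \<partial>(G \<Otimes>\<^sub>M H))"

lemma tau_mass_pos: "0 < tau_mass"
proof -
  show ?thesis unfolding tau_mass_def
  proof (subst P.integral_less_AE_space[of "\<lambda>_. 0", simplified])
    show "AE z in G \<Otimes>\<^sub>M H. 0 < tau_weight p z"
      using AE_pair_pos by eventually_elim (auto simp: tau_weight_def case_prod_beta)
  qed (auto simp: P.emeasure_space_1 integrable_tau_weight)
qed

lemma nn_integral_Z_law: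
  assumes [measurable]: "f \<in> borel_measurable borel"
  shows "ennreal tau_mass * (\<integral>\<^sup>+z. f z \<partial>Z_law p G H)
    = (\<integral>\<^sup>+v. \<integral>\<^sup>+w. ennreal (tau_weight p (v, w)) * f (4 * v * w / (v + 4 * w)) \<partial>H \<partial>G)"
proof -
  have *: "ennreal tau_mass * (ennreal (tau_weight p z / tau_mass) * c) = ennreal (tau_weight p z) * c" for z c
    using tau_mass_pos tau_weight_nonneg[of p z]
    by (simp add: mult.assoc[symmetric] ennreal_mult[symmetric])
  have "ennreal tau_mass * (\<integral>\<^sup>+z. f z \<partial>Z_law p G H)
    = (\<integral>\<^sup>+z. ennreal (tau_weight p z) * f (case z of (v, w) \<Rightarrow> 4 * v * w / (v + 4 * w)) \<partial>(G \<Otimes>\<^sub>M H))"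
    unfolding Z_law_def tau_def tau_mass_def[symmetric]
    by (simp add: nn_integral_distr nn_integral_density nn_integral_cmult[symmetric] * case_prod_beta)
  also have "\<dots> = (\<integral>\<^sup>+v. \<integral>\<^sup>+w. ennreal (tau_weight p (v, w)) * f (4 * v * w / (v + 4 * w)) \<partial>H \<partial>G)"
    by (subst H.nn_integral_fst[symmetric]) simp_all
  finally show ?thesis .
qed

lemma sets_Z_law [measurable_cong]: "sets (Z_law p G H) = sets borel"
  by (simp add: Z_law_def)

lemma AE_Z_law_pos: "AE z in Z_law p G H. 0 < z"
proof -
  have "AE x in G \<Otimes>\<^sub>M H. 0 < (case x of (v, w) \<Rightarrow> 4 * v * w / (v + 4 * w))"
    using AE_pair_pos by eventually_elim (auto intro!: divide_pos_pos mult_pos_pos add_pos_pos)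
  then show ?thesis
    unfolding Z_law_def tau_def by (subst AE_distr_iff) (auto simp: AE_density elim!: eventually_mono)
qed

text \<open>
  The sampling density times the slope of the loss is a multiple of \<open>p\<^sup>*\<close>.  This is the reason why quadratic risk
  under \<open>p\<^sup>*\<close> governs \<open>L\<^sub>1\<close> risk.
\<close>

lemma density_slope_eq_kernel:
  fixes s :: "real ^ 'p"
  assumes s: "s \<noteq> 0" and card: "p = CARD('p)"
  shows "ennreal (SN G s) * mixed_slope H (norm s)
    = ennreal (2 ^ p / sqrt (2 * pi) * tau_mass)
        * (\<integral>\<^sup>+z. ennreal (normal_kernel z s / norm s) \<partial>Z_law p G H)"
proof -
  have "ennreal (SN G s) * mixed_slope H (norm s)
      = (\<integral>\<^sup>+v. \<integral>\<^sup>+w. ennreal (normal_kernel v s) * ennreal (normal_density 0 (sqrt w) (norm s / 2) / norm s) \<partial>H \<partial>G)"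
    using G card unfolding mixed_slope_def
    by (simp add: nn_integral_cmult nn_integral_multc ennreal_SN)
  also have "\<dots> = (\<integral>\<^sup>+v. \<integral>\<^sup>+w. ennreal (2 ^ p / sqrt (2 * pi)) * (ennreal (tau_weight p (v, w))
      * ennreal (normal_kernel (4 * v * w / (v + 4 * w)) s / norm s)) \<partial>H \<partial>G)"
  proof (rule nn_integral_cong_AE)
    have "ennreal (normal_kernel v s) * ennreal (normal_density 0 (sqrt w) (norm s / 2) / norm s)
        = ennreal (2 ^ p / sqrt (2 * pi)) * (ennreal (tau_weight p (v, w))
      * ennreal (normal_kernel (4 * v * w / (v + 4 * w)) s / norm s))" if "0 < v" "0 < w" for v w
      using tau_weight_identity[OF that s] tau_weight_nonneg[of p]
      by (simp add: ennreal_mult[symmetric] card mult.assoc)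
    then show "AE v in G. (\<integral>\<^sup>+w. ennreal (normal_kernel v s) * ennreal (normal_density 0 (sqrt w) (norm s / 2) / norm s) \<partial>H)
      = (\<integral>\<^sup>+w. ennreal (2 ^ p / sqrt (2 * pi)) * (ennreal (tau_weight p (v, w))
      * ennreal (normal_kernel (4 * v * w / (v + 4 * w)) s / norm s)) \<partial>H)"
      using mixing_lawD(3)[OF G] mixing_lawD(3)[OF H]
      by (auto intro!: nn_integral_cong_AE elim!: eventually_mono)
  qed
  also have "\<dots> = ennreal (2 ^ p / sqrt (2 * pi)) *
      (ennreal tau_mass * (\<integral>\<^sup>+z. ennreal (normal_kernel z s / norm s) \<partial>Z_law p G H))"
    by (simp add: nn_integral_Z_law nn_integral_cmult)
  also have "\<dots> = ennreal (2 ^ p / sqrt (2 * pi) * tau_mass)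
      * (\<integral>\<^sup>+z. ennreal (normal_kernel z s / norm s) \<partial>Z_law p G H)"
    using tau_mass_pos by (subst ennreal_mult) (auto simp: mult.assoc)
  finally show ?thesis .
qed

lemma ennreal_pstar_kernel:
  fixes s :: "real ^ 'p"
  assumes s: "s \<noteq> 0" and card: "p = CARD('p)"
  shows "ennreal (pstar_kernel (Z_law p G H) s) = (\<integral>\<^sup>+z. ennreal (normal_kernel z s / norm s) \<partial>Z_law p G H)"
proof -
  let ?F = "Z_law p G H"
  have fin: "(\<integral>\<^sup>+z. ennreal (normal_kernel z s / norm s) \<partial>?F) < \<infinity>"
  proof -
    have "mixed_slope H (norm s) \<noteq> \<top>"
      using mixed_slope_bound[OF H, of "norm s"] s by (auto simp: ennreal_top_mult top_unique)
    then have "ennreal (2 ^ p / sqrt (2 * pi) * tau_mass)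
        * (\<integral>\<^sup>+z. ennreal (normal_kernel z s / norm s) \<partial>?F) \<noteq> \<top>"
      unfolding density_slope_eq_kernel[OF s card, symmetric] by (simp add: ennreal_mult_eq_top_iff)
    then show ?thesis
      using tau_mass_pos by (auto simp: ennreal_mult_eq_top_iff less_top)
  qed
  then have "integrable ?F (\<lambda>z. normal_kernel z s / norm s)"
    by (intro integrableI_nonneg) auto
  then have "(\<integral>\<^sup>+z. ennreal (normal_kernel z s / norm s) \<partial>?F) = ennreal (\<integral>z. normal_kernel z s / norm s \<partial>?F)"
    by (intro nn_integral_eq_integral) auto
  also have "(\<integral>z. normal_kernel z s / norm s \<partial>?F) = 1 / norm s * (\<integral>z. normal_kernel z s \<partial>?F)"
    by simp
  also have "(\<integral>z. normal_kernel z s \<partial>?F) = (LINT z:{0<..}|?F. normal_kernel z s)"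
    unfolding set_lebesgue_integral_def
    using AE_Z_law_pos by (intro integral_cong_AE) (auto elim!: eventually_mono)
  finally show ?thesis by (simp add: pstar_kernel_def)
qed

end

section \<open>From quadratic risk to L1 risk\<close>

context mixing_pair
begin

text \<open>
  The density \<open>p\<^sup>*\<close> up to its normalizing constant, as an extended nonnegative number.
\<close>

definition pstar_weight :: "real ^ 'p \<Rightarrow> ennreal" where
  "pstar_weight s = (\<integral>\<^sup>+z. ennreal (normal_kernel z s / norm s) \<partial>Z_law p G H)"

definition pstar_risk :: "(real ^ 'p \<Rightarrow> real ^ 'p) \<Rightarrow> real ^ 'p \<Rightarrow> ennreal" where
  "pstar_risk m \<mu> = (\<integral>\<^sup>+x. pstar_weight (x - \<mu>) * sq_loss \<mu> (m x) \<partial>lborel)"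

definition L1_risk :: "(real ^ 'p \<Rightarrow> real ^ 'p) \<Rightarrow> real ^ 'p \<Rightarrow> ennreal" where
  "L1_risk m \<mu> = (\<integral>\<^sup>+x. ennreal (SN G (x - \<mu>)) * mixed_L1_distance H (norm (m x - \<mu>)) \<partial>lborel)"

lemma prob_space_Z_law: "prob_space (Z_law p G H)"
proof -
  have "ennreal tau_mass * emeasure (Z_law p G H) UNIV
      = (\<integral>\<^sup>+v. \<integral>\<^sup>+w. ennreal (tau_weight p (v, w)) \<partial>H \<partial>G)"
    using nn_integral_Z_law[of "\<lambda>_. 1"] by (simp add: sets_eq_imp_space_eq[OF sets_Z_law])
  also have "\<dots> = ennreal tau_mass"
    unfolding tau_mass_def by (subst H.nn_integral_fst)
      (auto intro!: nn_integral_eq_integral integrable_tau_weight simp: tau_weight_nonneg)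
  finally have "ennreal tau_mass * emeasure (Z_law p G H) UNIV = ennreal tau_mass * 1"
    by simp
  then have "emeasure (Z_law p G H) UNIV = 1"
    using tau_mass_pos by (subst (asm) ennreal_mult_cancel_left) auto
  then show ?thesis
    by (intro prob_spaceI) (simp add: sets_eq_imp_space_eq[OF sets_Z_law])
qed

lemma measurable_pstar_weight [measurable]:
  "(pstar_weight :: real ^ 'p \<Rightarrow> ennreal) \<in> borel_measurable borel"
proof -
  interpret F: prob_space "Z_law p G H" by (rule prob_space_Z_law)
  show ?thesis unfolding pstar_weight_def[abs_def] by measurable
qed

lemma L1_risk_le_2:
  fixes \<mu> :: "real ^ 'p"
  assumes card: "p = CARD('p)"
  shows "L1_risk m \<mu> \<le> 2"
proof -
  have [measurable]: "(SN G :: real ^ 'p \<Rightarrow> real) \<in> borel_measurable borel"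
    using measurable_SN[OF G[unfolded card]] .
  have "L1_risk m \<mu> \<le> (\<integral>\<^sup>+x. ennreal (SN G (x + - \<mu>)) * 2 \<partial>lborel)"
    unfolding L1_risk_def using mixed_L1_distance_le_2[OF H]
    by (auto intro!: nn_integral_mono mult_left_mono)
  also have "\<dots> = (\<integral>\<^sup>+x. ennreal (SN G (x :: real ^ 'p)) * 2 \<partial>lborel)"
    by (rule nn_integral_translate[of "\<lambda>x :: real ^ 'p. ennreal (SN G x) * 2" "- \<mu>"]) simp
  also have "\<dots> = 2"
    using nn_integral_SN[OF G[unfolded card]] by (simp add: nn_integral_multc)
  finally show ?thesis .
qed

text \<open>
  Integrate the tangent inequality of the loss at \<open>\<parallel>x - \<mu>\<parallel>\<close> against the sampling density.  All terms are written as sums of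
  nonnegative quantities; the bound \<open>c * pstar_risk (\<lambda>x. x) \<mu> \<le> 1\<close> is what allows them to be cancelled later.
\<close>

lemma L1_risk_tangent:
  fixes \<mu> :: "real ^ 'p"
  assumes card: "p = CARD('p)" and [measurable]: "m \<in> borel_measurable borel"
  obtains c where "0 < c" "c < \<top>" "c * pstar_risk (\<lambda>x. x) \<mu> \<le> 1"
    "L1_risk m \<mu> + c * pstar_risk (\<lambda>x. x) \<mu> \<le> L1_risk (\<lambda>x. x) \<mu> + c * pstar_risk m \<mu>"
    "\<not> (AE x in lborel. norm (m x - \<mu>) = norm (x - \<mu>)) \<Longrightarrow>
      L1_risk m \<mu> + c * pstar_risk (\<lambda>x. x) \<mu> < L1_risk (\<lambda>x. x) \<mu> + c * pstar_risk m \<mu>"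
proof -
  define c where "c = ennreal (2 ^ p / sqrt (2 * pi) * tau_mass)"
  have SN [measurable]: "(SN G :: real ^ 'p \<Rightarrow> real) \<in> borel_measurable borel"
    using measurable_SN[OF G[unfolded card]] .
  have [measurable]: "mixed_L1_distance H \<in> borel_measurable borel" "mixed_slope H \<in> borel_measurable borel"
    using H by (rule measurable_mixed_distance_slope)+
  let ?f = "\<lambda>x. ennreal (SN G (x - \<mu>))" and ?s = "\<lambda>x. norm (x - \<mu>)"
  have nz: "AE x in lborel. x \<noteq> \<mu>" by (rule AE_lborel_singleton)
  have risk: "c * pstar_risk m' \<mu> = (\<integral>\<^sup>+x. ?f x * (mixed_slope H (?s x) * ennreal ((norm (m' x - \<mu>))\<^sup>2)) \<partial>lborel)"
    if [measurable]: "m' \<in> borel_measurable borel" for m'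
  proof -
    have "c * pstar_risk m' \<mu> = (\<integral>\<^sup>+x. c * (pstar_weight (x - \<mu>) * sq_loss \<mu> (m' x)) \<partial>lborel)"
      unfolding pstar_risk_def by (rule nn_integral_cmult[symmetric]) (simp add: sq_loss_def)
    also have "\<dots> = (\<integral>\<^sup>+x. ?f x * (mixed_slope H (?s x) * ennreal ((norm (m' x - \<mu>))\<^sup>2)) \<partial>lborel)"
      using nz
    proof (intro nn_integral_cong_AE, eventually_elim)
      case (elim x)
      then have "c * pstar_weight (x - \<mu>) = ?f x * mixed_slope H (?s x)"
        using density_slope_eq_kernel[of "x - \<mu>", OF _ card] by (simp add: c_def pstar_weight_def)
      then show ?case by (simp add: sq_loss_def mult.assoc[symmetric])
    qed
    finally show ?thesis .
  qed
  define A where "A x = mixed_L1_distance H (norm (m x - \<mu>)) + mixed_slope H (?s x) * ennreal ((?s x)\<^sup>2)" for x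
  define B where "B x = mixed_L1_distance H (?s x) + mixed_slope H (?s x) * ennreal ((norm (m x - \<mu>))\<^sup>2)" for x
  have [measurable]: "A \<in> borel_measurable borel" "B \<in> borel_measurable borel"
    unfolding A_def[abs_def] B_def[abs_def] by measurable
  have L: "L1_risk m \<mu> + c * pstar_risk (\<lambda>x. x) \<mu> = (\<integral>\<^sup>+x. ?f x * A x \<partial>lborel)"
    unfolding L1_risk_def A_def by (simp add: risk distrib_left nn_integral_add)
  have R: "L1_risk (\<lambda>x. x) \<mu> + c * pstar_risk m \<mu> = (\<integral>\<^sup>+x. ?f x * B x \<partial>lborel)"
    unfolding L1_risk_def B_def by (simp add: risk distrib_left nn_integral_add)
  have le: "AE x in lborel. ?f x * A x \<le> ?f x * B x"
    using nz by eventually_elim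
      (auto simp: A_def B_def intro!: mult_left_mono mixed_L1_distance_tangent(1)[OF H])
  have int: "c * pstar_risk (\<lambda>x. x) \<mu> \<le> 1"
  proof -
    have "c * pstar_risk (\<lambda>x. x) \<mu> \<le> (\<integral>\<^sup>+x. ?f x \<partial>lborel)"
      unfolding risk[OF measurable_ident_sets[OF refl]] using nz
    proof (intro nn_integral_mono_AE, eventually_elim)
      case (elim x)
      then have "?f x * (mixed_slope H (?s x) * ennreal ((?s x)\<^sup>2)) \<le> ?f x * 1"
        by (intro mult_left_mono mixed_slope_bound[OF H]) auto
      then show ?case by simp
    qed
    also have "\<dots> = 1"
      using nn_integral_translate[of "\<lambda>x. ennreal (SN G (x :: real ^ 'p))" "- \<mu>"]
        nn_integral_SN[OF G[unfolded card]] by simp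
    finally show ?thesis .
  qed
  have fin: "(\<integral>\<^sup>+x. ?f x * A x \<partial>lborel) \<noteq> \<infinity>"
  proof -
    have "(\<integral>\<^sup>+x. ?f x * A x \<partial>lborel) \<le> 2 + 1"
      unfolding L[symmetric] by (intro add_mono L1_risk_le_2[OF card] int)
    then show ?thesis by (auto simp: top_unique)
  qed
  show thesis
  proof (rule that)
    show "0 < c" "c < \<top>" using tau_mass_pos by (auto simp: c_def)
    show "c * pstar_risk (\<lambda>x. x) \<mu> \<le> 1" by (rule int)
    show "L1_risk m \<mu> + c * pstar_risk (\<lambda>x. x) \<mu> \<le> L1_risk (\<lambda>x. x) \<mu> + c * pstar_risk m \<mu>"
      unfolding L R using le by (rule nn_integral_mono_AE)
    assume *: "\<not> (AE x in lborel. norm (m x - \<mu>) = norm (x - \<mu>))"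
    show "L1_risk m \<mu> + c * pstar_risk (\<lambda>x. x) \<mu> < L1_risk (\<lambda>x. x) \<mu> + c * pstar_risk m \<mu>"
      unfolding L R
    proof (rule nn_integral_less[OF _ _ fin le])
      show "\<not> (AE x in lborel. ?f x * B x \<le> ?f x * A x)"
      proof
        assume "AE x in lborel. ?f x * B x \<le> ?f x * A x"
        with nz have "AE x in lborel. norm (m x - \<mu>) = norm (x - \<mu>)"
        proof eventually_elim
          case (elim x)
          show ?case
          proof (rule ccontr)
            assume "norm (m x - \<mu>) \<noteq> norm (x - \<mu>)"
            then have "A x < B x"
              unfolding A_def B_def using elim
              by (intro mixed_L1_distance_tangent(2)[OF H]) auto
            moreover have "0 < SN G (x - \<mu>)" using SN_pos[OF G[unfolded card]] .
            ultimately have "?f x * A x < ?f x * B x" by (simp add: ennreal_mult_strict_left_mono)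
            with elim show False by simp
          qed
        qed
        with * show False by simp
      qed
    qed simp_all
  qed
qed

text \<open>
  The \<open>L\<^sub>1\<close> risks and the quadratic risk of the identity are finite, so the common terms of the integrated tangent inequality can be cancelled.
\<close>

lemma L1_risk_improvement:
  fixes \<mu> :: "real ^ 'p"
  assumes card: "p = CARD('p)" and m: "m \<in> borel_measurable borel"
  shows "pstar_risk m \<mu> \<le> pstar_risk (\<lambda>x. x) \<mu> \<Longrightarrow> L1_risk m \<mu> \<le> L1_risk (\<lambda>x. x) \<mu>"
    and "pstar_risk m \<mu> < pstar_risk (\<lambda>x. x) \<mu> \<Longrightarrow> L1_risk m \<mu> < L1_risk (\<lambda>x. x) \<mu>"
    and "pstar_risk m \<mu> \<le> pstar_risk (\<lambda>x. x) \<mu> \<Longrightarrow>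
      \<not> (AE x in lborel. norm (m x - \<mu>) = norm (x - \<mu>)) \<Longrightarrow> L1_risk m \<mu> < L1_risk (\<lambda>x. x) \<mu>"
proof -
  from L1_risk_tangent[OF card m, of \<mu>] obtain c where c: "0 < c" "c < \<top>"
    "c * pstar_risk (\<lambda>x. x) \<mu> \<le> 1"
    and le: "L1_risk m \<mu> + c * pstar_risk (\<lambda>x. x) \<mu> \<le> L1_risk (\<lambda>x. x) \<mu> + c * pstar_risk m \<mu>"
    and less: "\<not> (AE x in lborel. norm (m x - \<mu>) = norm (x - \<mu>)) \<Longrightarrow>
      L1_risk m \<mu> + c * pstar_risk (\<lambda>x. x) \<mu> < L1_risk (\<lambda>x. x) \<mu> + c * pstar_risk m \<mu>"
    by blast
  let ?r = "c * pstar_risk (\<lambda>x. x) \<mu>"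
  have fin: "?r \<noteq> \<top>" using c(3) by (auto simp: top_unique)
  have finL: "L1_risk (\<lambda>x. x) \<mu> \<noteq> \<top>"
    using L1_risk_le_2[OF card, of "\<lambda>x. x" \<mu>] by (auto simp: top_unique)
  { assume "pstar_risk m \<mu> \<le> pstar_risk (\<lambda>x. x) \<mu>"
    then have mono: "L1_risk (\<lambda>x. x) \<mu> + c * pstar_risk m \<mu> \<le> L1_risk (\<lambda>x. x) \<mu> + ?r"
      by (intro add_left_mono mult_left_mono) auto
    from order_trans[OF le mono] have "?r + L1_risk m \<mu> \<le> ?r + L1_risk (\<lambda>x. x) \<mu>" by (simp add: add.commute)
    with fin show "L1_risk m \<mu> \<le> L1_risk (\<lambda>x. x) \<mu>" by (simp add: ennreal_add_left_cancel_le)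
    assume "\<not> (AE x in lborel. norm (m x - \<mu>) = norm (x - \<mu>))"
    from less_le_trans[OF less[OF this] mono] have "?r + L1_risk m \<mu> < ?r + L1_risk (\<lambda>x. x) \<mu>" by (simp add: add.commute)
    with fin show "L1_risk m \<mu> < L1_risk (\<lambda>x. x) \<mu>" by (simp add: ennreal_add_left_cancel_less) }
  { assume "pstar_risk m \<mu> < pstar_risk (\<lambda>x. x) \<mu>"
    then have "c * pstar_risk m \<mu> < ?r"
      using c by (intro ennreal_mult_strict_left_mono) auto
    then have "L1_risk (\<lambda>x. x) \<mu> + c * pstar_risk m \<mu> < L1_risk (\<lambda>x. x) \<mu> + ?r"
      using finL by (simp add: ennreal_add_left_cancel_less)
    from le_less_trans[OF le this] have "?r + L1_risk m \<mu> < ?r + L1_risk (\<lambda>x. x) \<mu>" by (simp add: add.commute)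
    with fin show "L1_risk m \<mu> < L1_risk (\<lambda>x. x) \<mu>" by (simp add: ennreal_add_left_cancel_less) }
qed

end

section \<open>Gaussian averages of functions of the norm\<close>

text \<open>
  A Gaussian average of a function that decreases in the norm grows when the centre is moved towards the origin.
  The point reflection \<open>\<sigma>\<close> at the midpoint of the two centres exchanges them, so that each integral is half the integral of a sum over \<open>x\<close> and \<open>\<sigma> x\<close>.
  Of these two points the one with the smaller norm is also closer to \<open>s \<theta>\<close> than to \<open>\<theta>\<close>, and the inequality holds pointwise by rearrangement.
\<close>

lemma nn_integral_shift_antimono:
  fixes K :: "real ^ 'p \<Rightarrow> real"
  assumes v: "0 < v" and s: "0 \<le> s" "s \<le> 1" and [measurable]: "K \<in> borel_measurable borel"
    and nn: "\<And>x. 0 \<le> K x" and anti: "\<And>x y. x \<noteq> 0 \<Longrightarrow> norm x \<le> norm y \<Longrightarrow> K y \<le> K x"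
  shows "(\<integral>\<^sup>+x. ennreal (K x * normal_kernel v (x - \<theta>)) \<partial>lborel)
    \<le> (\<integral>\<^sup>+x. ennreal (K x * normal_kernel v (x - s *\<^sub>R \<theta>)) \<partial>lborel)"
proof -
  define \<sigma> where "\<sigma> y = (1 + s) *\<^sub>R \<theta> - y" for y
  have twice: "2 * (\<integral>\<^sup>+x. ennreal (K x * normal_kernel v (x - \<eta>)) \<partial>lborel)
      = (\<integral>\<^sup>+x. ennreal (K x * normal_kernel v (x - \<eta>) + K (\<sigma> x) * normal_kernel v (\<sigma> x - \<eta>)) \<partial>lborel)" for \<eta>
  proof -
    have "(\<integral>\<^sup>+x. ennreal (K (\<sigma> x) * normal_kernel v (\<sigma> x - \<eta>)) \<partial>lborel)
        = (\<integral>\<^sup>+x. ennreal (K x * normal_kernel v (x - \<eta>)) \<partial>lborel)"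
      unfolding \<sigma>_def by (rule nn_integral_reflect[where f = "\<lambda>x. ennreal (K x * normal_kernel v (x - \<eta>))"]) simp
    moreover have "(\<integral>\<^sup>+x. ennreal (K x * normal_kernel v (x - \<eta>) + K (\<sigma> x) * normal_kernel v (\<sigma> x - \<eta>)) \<partial>lborel)
      = (\<integral>\<^sup>+x. ennreal (K x * normal_kernel v (x - \<eta>)) \<partial>lborel) + (\<integral>\<^sup>+x. ennreal (K (\<sigma> x) * normal_kernel v (\<sigma> x - \<eta>)) \<partial>lborel)"
      using nn by (subst nn_integral_add[symmetric]) (simp_all add: \<sigma>_def)
    ultimately show ?thesis by (simp add: mult_2)
  qed
  \<comment> \<open>The reflection exchanges the two centres.\<close>
  have swap: "normal_kernel v (\<sigma> x - \<theta>) = normal_kernel v (x - s *\<^sub>R \<theta>)"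
      "normal_kernel v (\<sigma> x - s *\<^sub>R \<theta>) = normal_kernel v (x - \<theta>)" for x
  proof -
    have "\<sigma> x - \<theta> = - (x - s *\<^sub>R \<theta>)" "\<sigma> x - s *\<^sub>R \<theta> = - (x - \<theta>)"
      by (simp_all add: \<sigma>_def algebra_simps)
    then show "normal_kernel v (\<sigma> x - \<theta>) = normal_kernel v (x - s *\<^sub>R \<theta>)"
      "normal_kernel v (\<sigma> x - s *\<^sub>R \<theta>) = normal_kernel v (x - \<theta>)"
      by (simp_all only: normal_kernel_def norm_minus_cancel)
  qed
  have side: "norm (x - s *\<^sub>R \<theta>) \<le> norm (x - \<theta>) \<longleftrightarrow> norm x \<le> norm (\<sigma> x)" if "s < 1" for x
  proof -
    have "(norm (x - \<theta>))\<^sup>2 - (norm (x - s *\<^sub>R \<theta>))\<^sup>2 = (1 - s) * ((1 + s) * (\<theta> \<bullet> \<theta>) - 2 * (x \<bullet> \<theta>))"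
      unfolding power2_norm_eq_inner
      by (simp add: inner_diff_left inner_diff_right inner_commute[of \<theta> x] algebra_simps del: dot_square_norm)
    moreover have "(norm (\<sigma> x))\<^sup>2 - (norm x)\<^sup>2 = (1 + s) * ((1 + s) * (\<theta> \<bullet> \<theta>) - 2 * (x \<bullet> \<theta>))"
      unfolding power2_norm_eq_inner \<sigma>_def
      by (simp add: inner_diff_left inner_diff_right inner_commute[of \<theta> x] algebra_simps del: dot_square_norm)
    moreover have "0 \<le> (1 - s) * D \<longleftrightarrow> 0 \<le> (1 + s) * D" for D
      using s that by (simp add: zero_le_mult_iff)
    ultimately have "0 \<le> (norm (x - \<theta>))\<^sup>2 - (norm (x - s *\<^sub>R \<theta>))\<^sup>2 \<longleftrightarrow> 0 \<le> (norm (\<sigma> x))\<^sup>2 - (norm x)\<^sup>2"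
      by simp
    then show ?thesis by simp
  qed
  have "AE x in lborel. x \<noteq> 0 \<and> x \<noteq> (1 + s) *\<^sub>R \<theta>"
    using AE_lborel_singleton[of 0] AE_lborel_singleton[of "(1 + s) *\<^sub>R \<theta>"] by eventually_elim auto
  then have "AE x in lborel. K x * normal_kernel v (x - \<theta>) + K (\<sigma> x) * normal_kernel v (\<sigma> x - \<theta>)
      \<le> K x * normal_kernel v (x - s *\<^sub>R \<theta>) + K (\<sigma> x) * normal_kernel v (\<sigma> x - s *\<^sub>R \<theta>)"
  proof eventually_elim
    case (elim x)
    then have nz: "x \<noteq> 0" "\<sigma> x \<noteq> 0" by (auto simp: \<sigma>_def)
    let ?a = "normal_kernel v (x - \<theta>)" and ?b = "normal_kernel v (x - s *\<^sub>R \<theta>)"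
    have "0 \<le> (K x - K (\<sigma> x)) * (?b - ?a)"
    proof (cases "s = 1")
      case False
      with s have s1: "s < 1" by simp
      show ?thesis
      proof (cases "norm x \<le> norm (\<sigma> x)")
        case True
        with side[OF s1, of x] anti[OF nz(1) True] v show ?thesis
          by (intro mult_nonneg_nonneg) (auto simp: normal_kernel_le_iff)
      next
        case False
        with side[OF s1, of x] anti[OF nz(2), of x] v show ?thesis
          by (intro mult_nonpos_nonpos) (auto simp: normal_kernel_le_iff)
      qed
    qed simp
    then show ?case unfolding swap by (simp add: algebra_simps)
  qed
  then have "2 * (\<integral>\<^sup>+x. ennreal (K x * normal_kernel v (x - \<theta>)) \<partial>lborel)
      \<le> 2 * (\<integral>\<^sup>+x. ennreal (K x * normal_kernel v (x - s *\<^sub>R \<theta>)) \<partial>lborel)"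
    unfolding twice by (intro nn_integral_mono_AE) (auto elim!: eventually_mono intro!: ennreal_leI)
  then show ?thesis by (subst (asm) ennreal_mult_le_mult_iff) auto
qed

text \<open>
  A Gaussian factor adds \<open>2 c\<close> to the precision \<open>1 / v\<close>.
\<close>

lemma normal_kernel_tilt:
  fixes x :: "real ^ 'p"
  assumes v: "0 < v" and c: "0 \<le> c"
  shows "exp (- (c * (norm x)\<^sup>2)) * normal_kernel v x
    = (1 + 2 * c * v) powr (- (real CARD('p) / 2)) * normal_kernel (v / (1 + 2 * c * v)) x"
proof -
  have pos: "0 < 1 + 2 * c * v" using v c by (simp add: add_pos_nonneg)
  have "(2 * pi * v) powr (- (real CARD('p) / 2))
      = (1 + 2 * c * v) powr (- (real CARD('p) / 2)) * (2 * pi * (v / (1 + 2 * c * v))) powr (- (real CARD('p) / 2))"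
    using v pos by (subst powr_mult[symmetric]) auto
  moreover have "exp (- (c * (norm x)\<^sup>2)) * exp (- ((norm x)\<^sup>2 / (2 * v)))
      = exp (- ((norm x)\<^sup>2 / (2 * (v / (1 + 2 * c * v)))))"
    unfolding exp_add[symmetric] using v pos by (simp add: field_simps)
  ultimately show ?thesis
    by (simp add: normal_kernel_def)
qed

text \<open>
  It suffices to take \<open>\<mu> = 0\<close>, by the preceding monotonicity.  There
  \<open>\<parallel>x\<parallel>\<^sup>-\<^sup>2 = \<integral> exp (- u \<parallel>x\<parallel>\<^sup>2) du\<close> over \<open>u \<ge> 0\<close> turns the integral into that of \<open>(1 + 2 u v)\<^sup>-\<^sup>p\<^sup>/\<^sup>2\<close>, which converges for \<open>p \<ge> 3\<close>.
\<close>

lemma nn_integral_inverse_norm2_finite: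
  fixes \<mu> :: "real ^ 'p"
  assumes v: "0 < v" and p: "CARD('p) \<ge> 3"
  shows "(\<integral>\<^sup>+x. ennreal (inverse ((norm x)\<^sup>2) * normal_kernel v (x - \<mu>)) \<partial>lborel) < \<infinity>"
proof -
  have "(\<integral>\<^sup>+x. ennreal (inverse ((norm x)\<^sup>2) * normal_kernel v (x - \<mu>)) \<partial>lborel)
      \<le> (\<integral>\<^sup>+x. ennreal (inverse ((norm x)\<^sup>2) * normal_kernel v (x - 0 *\<^sub>R \<mu>)) \<partial>lborel)"
    using v by (intro nn_integral_shift_antimono) (auto intro!: le_imp_inverse_le power_mono)
  also have "\<dots> = (\<integral>\<^sup>+x. (\<integral>\<^sup>+u. ennreal (exp (- (u * (norm x)\<^sup>2)) * normal_kernel v (x :: real ^ 'p)) * indicator {0..} u \<partial>lborel) \<partial>lborel)"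
  proof (rule nn_integral_cong_AE)
    show "AE x in lborel :: (real ^ 'p) measure. ennreal (inverse ((norm x)\<^sup>2) * normal_kernel v (x - 0 *\<^sub>R \<mu>))
      = (\<integral>\<^sup>+u. ennreal (exp (- (u * (norm x)\<^sup>2)) * normal_kernel v x) * indicator {0..} u \<partial>lborel)"
      using AE_lborel_singleton[of 0]
    proof eventually_elim
      case (elim x)
      let ?c = "(norm x)\<^sup>2"
      have c: "0 < ?c" using elim by simp
      have "((\<lambda>u. - exp (- (u * ?c)) * inverse ?c) \<longlongrightarrow> - 0 * inverse ?c) at_top"
        using c by (intro tendsto_mult tendsto_minus tendsto_const filterlim_compose[OF exp_at_bot]
          filterlim_compose[OF filterlim_uminus_at_bot_at_top] filterlim_at_top_mult_tendsto_pos[OF tendsto_const] filterlim_ident)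
           (auto simp: mult.commute)
      then have "(\<integral>\<^sup>+u. ennreal (exp (- (u * ?c))) * indicator {0..} u \<partial>lborel) = ennreal (0 - (- exp (- (0 * ?c)) * inverse ?c))"
        using c by (intro nn_integral_FTC_atLeast) (auto intro!: derivative_eq_intros)
      then have "(\<integral>\<^sup>+u. ennreal (exp (- (u * ?c))) * indicator {0..} u \<partial>lborel) = ennreal (inverse ?c)" by simp
      then show ?case
        by (simp add: ennreal_mult' mult.assoc mult.commute[of _ "ennreal (normal_kernel v x)"] nn_integral_cmult
            mult.left_commute[of _ "ennreal (normal_kernel v x)"])
    qed
  qed
  also have "\<dots> = (\<integral>\<^sup>+u. (\<integral>\<^sup>+x. ennreal (exp (- (u * (norm x)\<^sup>2)) * normal_kernel v (x :: real ^ 'p)) * indicator {0..} u \<partial>lborel) \<partial>lborel)"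
    by (rule lborel_pair.Fubini') simp
  also have "\<dots> = (\<integral>\<^sup>+u. ennreal ((1 + 2 * u * v) powr (- (real CARD('p) / 2))) * indicator {0..} u \<partial>lborel)"
  proof (rule nn_integral_cong)
    fix u :: real
    show "(\<integral>\<^sup>+x. ennreal (exp (- (u * (norm x)\<^sup>2)) * normal_kernel v (x :: real ^ 'p)) * indicator {0..} u \<partial>lborel)
        = ennreal ((1 + 2 * u * v) powr (- (real CARD('p) / 2))) * indicator {0..} u"
    proof (cases "0 \<le> u")
      case True
      then have "0 < v / (1 + 2 * u * v)" using v by (intro divide_pos_pos add_pos_nonneg) auto
      with True show ?thesis
        by (simp add: normal_kernel_tilt[OF v True] ennreal_mult nn_integral_cmult nn_integral_normal_kernel)
    qed simp
  qed
  also have "\<dots> \<le> (\<integral>\<^sup>+u. ennreal ((1 + 2 * u * v) powr (- 3 / 2)) * indicator {0..} u \<partial>lborel)"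
    using v p by (intro nn_integral_mono) (auto simp: indicator_def intro!: ennreal_leI powr_mono)
  also have "\<dots> = ennreal (0 - (- inverse v * (1 + 2 * 0 * v) powr (- 1 / 2)))"
  proof (rule nn_integral_FTC_atLeast)
    show "((\<lambda>u. - inverse v * (1 + 2 * u * v) powr (- 1 / 2)) \<longlongrightarrow> 0) at_top"
    proof -
      have "filterlim (\<lambda>u. 1 + 2 * u * v) at_top at_top"
        using v by (intro filterlim_tendsto_add_at_top[OF tendsto_const]
          filterlim_at_top_mult_tendsto_pos[OF tendsto_const] filterlim_tendsto_pos_mult_at_top[OF tendsto_const]) (auto simp: filterlim_ident)
      then have "((\<lambda>u. (1 + 2 * u * v) powr (- 1 / 2)) \<longlongrightarrow> 0) at_top"
        by (intro tendsto_neg_powr) auto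
      from tendsto_mult_left[OF this, of "- inverse v"] show ?thesis by simp
    qed
    fix u :: real assume "0 \<le> u"
    then have "0 < 1 + 2 * u * v" using v by (simp add: add_pos_nonneg)
    then show "((\<lambda>u. - inverse v * (1 + 2 * u * v) powr (- 1 / 2)) has_real_derivative (1 + 2 * u * v) powr (- 3 / 2)) (at u)"
      using v by (auto intro!: derivative_eq_intros simp: field_simps)
  qed simp_all
  also have "\<dots> < \<infinity>" by simp
  finally show ?thesis .
qed

lemma integrable_inverse_norm2:
  fixes \<mu> :: "real ^ 'p"
  assumes "0 < v" and "CARD('p) \<ge> 3"
  shows "integrable lborel (\<lambda>x. inverse ((norm x)\<^sup>2) * normal_kernel v (x - \<mu>))"
  using nn_integral_inverse_norm2_finite[OF assms, of \<mu>] by (intro integrableI_nonneg) auto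

lemma integrable_normal_kernel:
  fixes \<mu> :: "real ^ 'p"
  assumes "0 < v"
  shows "integrable lborel (\<lambda>x. normal_kernel v (x - \<mu>))"
proof (rule integrableI_nonneg)
  show "(\<integral>\<^sup>+x. ennreal (normal_kernel v (x - \<mu>)) \<partial>lborel) < \<infinity>"
    using nn_integral_translate[of "\<lambda>x. ennreal (normal_kernel v x)" "- \<mu>"] assms
    by (simp add: nn_integral_normal_kernel)
qed auto

lemma integrable_norm2_normal_kernel:
  fixes \<mu> :: "real ^ 'p"
  assumes v: "0 < v"
  shows "integrable lborel (\<lambda>x. (norm (x - \<mu>))\<^sup>2 * normal_kernel v (x - \<mu>))"
proof (rule Bochner_Integration.integrable_bound)
  show "integrable lborel (\<lambda>x. 4 * v * 2 powr (real CARD('p) / 2) * normal_kernel (2 * v) (x - \<mu>))"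
    using integrable_normal_kernel[of "2 * v" \<mu>] v by simp
  have "s\<^sup>2 * exp (- (s\<^sup>2 / (2 * v))) \<le> 4 * v * exp (- (s\<^sup>2 / (2 * (2 * v))))" for s :: real
  proof -
    have "s\<^sup>2 / (4 * v) \<le> exp (s\<^sup>2 / (4 * v))" using exp_ge_add_one_self[of "s\<^sup>2 / (4 * v)"] by linarith
    then have "s\<^sup>2 \<le> 4 * v * exp (s\<^sup>2 / (4 * v))" using v by (simp add: field_simps)
    then have "s\<^sup>2 * exp (- (s\<^sup>2 / (2 * v))) \<le> 4 * v * exp (s\<^sup>2 / (4 * v)) * exp (- (s\<^sup>2 / (2 * v)))"
      by (intro mult_right_mono) auto
    also have "\<dots> = 4 * v * exp (- (s\<^sup>2 / (2 * (2 * v))))"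
      using v by (simp add: mult.assoc exp_add[symmetric] field_simps)
    finally show ?thesis .
  qed
  then have "(norm y)\<^sup>2 * normal_kernel v y \<le> 4 * v * 2 powr (real CARD('p) / 2) * normal_kernel (2 * v) y" for y :: "real ^ 'p"
  proof -
    assume *: "\<And>s. s\<^sup>2 * exp (- (s\<^sup>2 / (2 * v))) \<le> 4 * v * exp (- (s\<^sup>2 / (2 * (2 * v))))"
    have "(norm y)\<^sup>2 * normal_kernel v y = (2 * pi * v) powr (- (real CARD('p) / 2)) * ((norm y)\<^sup>2 * exp (- ((norm y)\<^sup>2 / (2 * v))))"
      by (simp add: normal_kernel_def)
    also have "\<dots> \<le> (2 * pi * v) powr (- (real CARD('p) / 2)) * (4 * v * exp (- ((norm y)\<^sup>2 / (2 * (2 * v)))))"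
      by (intro mult_left_mono *) auto
    also have "(2 * pi * v) powr (- (real CARD('p) / 2)) = 2 powr (real CARD('p) / 2) * (2 * pi * (2 * v)) powr (- (real CARD('p) / 2))"
      using v powr_add[of 2 "real CARD('p) / 2" "real CARD('p) / 2"]
      by (simp add: powr_mult powr_minus field_simps)
    finally show ?thesis by (simp add: normal_kernel_def mult_ac)
  qed
  then show "AE x in lborel. norm ((norm (x - \<mu>))\<^sup>2 * normal_kernel v (x - \<mu>))
      \<le> norm (4 * v * 2 powr (real CARD('p) / 2) * normal_kernel (2 * v) (x - \<mu>))"
    using v by (auto simp: abs_mult)
qed simp

section \<open>Baranchik estimators of a normal mean\<close>

text \<open>
  Monotonicity on the whole line, rather than on \<open>(0, \<infinity>)\<close>, makes \<open>r\<close> Borel measurable.  A function given on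
  \<open>(0, \<infinity>)\<close> is extended by \<open>0\<close>.
\<close>

locale shrinkage_function =
  fixes r :: "real \<Rightarrow> real"
  assumes mono: "mono r" and nonneg: "0 \<le> r t" and le_1: "r t \<le> 1"
    and ratio_antimono: "0 < s \<Longrightarrow> s \<le> t \<Longrightarrow> r t / t \<le> r s / s"
begin

lemma measurable_r [measurable]: "r \<in> borel_measurable borel"
  using mono by (rule borel_measurable_mono)

definition ratio :: "real ^ 'p \<Rightarrow> real" where
  "ratio x = r (x \<bullet> x) / (x \<bullet> x)"

lemma measurable_ratio [measurable]: "ratio \<in> borel_measurable borel"
  unfolding ratio_def[abs_def] by measurable

lemma ratio_nonneg: "0 \<le> ratio x"
  by (simp add: ratio_def nonneg)

lemma ratio_le: "ratio x \<le> inverse ((norm x)\<^sup>2)"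
  using le_1[of "x \<bullet> x"] by (simp add: ratio_def dot_square_norm divide_inverse mult_left_le_one_le nonneg)

lemma ratio_times_norm2: "x \<noteq> 0 \<Longrightarrow> ratio x * (norm x)\<^sup>2 = r (x \<bullet> x)"
  by (simp add: ratio_def dot_square_norm)

lemma integrable_ratio:
  fixes \<mu> :: "real ^ 'p"
  assumes v: "0 < v" and p: "CARD('p) \<ge> 3"
  shows "integrable lborel (\<lambda>x. ratio x * normal_kernel v (x - \<mu>))"
  using integrable_inverse_norm2[OF v p, of \<mu>]
  by (rule Bochner_Integration.integrable_bound)
     (auto simp: abs_mult ratio_nonneg intro!: mult_right_mono ratio_le)

lemma integrable_r_normal:
  fixes \<mu> :: "real ^ 'p"
  assumes v: "0 < v"
  shows "integrable lborel (\<lambda>x. r (x \<bullet> x) * normal_kernel v (x - \<mu>))"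
  using integrable_normal_kernel[OF v, of \<mu>]
  by (rule Bochner_Integration.integrable_bound)
     (auto simp: abs_mult nonneg le_1 intro!: mult_left_le_one_le)

lemma integrable_ratio_inner:
  fixes \<mu> :: "real ^ 'p"
  assumes v: "0 < v" and p: "CARD('p) \<ge> 3"
  shows "integrable lborel (\<lambda>x. ratio x * (x \<bullet> (x - \<mu>)) * normal_kernel v (x - \<mu>))"
proof (rule Bochner_Integration.integrable_bound)
  show "integrable lborel (\<lambda>x. inverse ((norm x)\<^sup>2) * normal_kernel v (x - \<mu>) + (norm (x - \<mu>))\<^sup>2 * normal_kernel v (x - \<mu>))"
    by (intro Bochner_Integration.integrable_add integrable_inverse_norm2 integrable_norm2_normal_kernel v p)
  show "AE x in lborel. norm (ratio x * (x \<bullet> (x - \<mu>)) * normal_kernel v (x - \<mu>))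
    \<le> norm (inverse ((norm x)\<^sup>2) * normal_kernel v (x - \<mu>) + (norm (x - \<mu>))\<^sup>2 * normal_kernel v (x - \<mu>))"
  proof (rule AE_I2)
    fix x
    have "\<bar>ratio x * (x \<bullet> (x - \<mu>))\<bar> \<le> inverse ((norm x)\<^sup>2) * (norm x * norm (x - \<mu>))"
      unfolding abs_mult abs_of_nonneg[OF ratio_nonneg]
      by (intro mult_mono ratio_le Cauchy_Schwarz_ineq2) auto
    also have "\<dots> = inverse (norm x) * norm (x - \<mu>)"
      by (cases "x = 0") (simp_all add: power2_eq_square)
    also have "\<dots> \<le> inverse ((norm x)\<^sup>2) + (norm (x - \<mu>))\<^sup>2"
    proof -
      have "2 * (inverse (norm x) * norm (x - \<mu>)) \<le> (inverse (norm x))\<^sup>2 + (norm (x - \<mu>))\<^sup>2"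
        using sum_squares_bound[of "inverse (norm x)" "norm (x - \<mu>)"] by (simp add: mult.assoc)
      moreover have "0 \<le> inverse (norm x) * norm (x - \<mu>)" by simp
      ultimately show ?thesis unfolding power_inverse by linarith
    qed
    finally have "\<bar>ratio x * (x \<bullet> (x - \<mu>))\<bar> * normal_kernel v (x - \<mu>)
        \<le> (inverse ((norm x)\<^sup>2) + (norm (x - \<mu>))\<^sup>2) * normal_kernel v (x - \<mu>)"
      by (intro mult_right_mono) auto
    then show "norm (ratio x * (x \<bullet> (x - \<mu>)) * normal_kernel v (x - \<mu>))
    \<le> norm (inverse ((norm x)\<^sup>2) * normal_kernel v (x - \<mu>) + (norm (x - \<mu>))\<^sup>2 * normal_kernel v (x - \<mu>))"
      by (simp add: abs_mult distrib_right)
  qed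
qed simp

lemma ratio_dilate:
  assumes "1 \<le> l"
  shows "ratio x \<le> l\<^sup>2 * ratio (l *\<^sub>R x)"
proof -
  have "x \<bullet> x \<le> l\<^sup>2 * (x \<bullet> x)" using assms by (simp add: mult_right_mono[of 1 "l\<^sup>2" "x \<bullet> x", simplified])
  then have "r (x \<bullet> x) \<le> r (l\<^sup>2 * (x \<bullet> x))" using mono by (auto dest: monoD)
  then have "r (x \<bullet> x) / (x \<bullet> x) \<le> r (l\<^sup>2 * (x \<bullet> x)) / (x \<bullet> x)"
    by (intro divide_right_mono) auto
  then show ?thesis using assms by (simp add: ratio_def power2_eq_square mult.assoc)
qed

lemma normal_kernel_dilate_ge:
  fixes x \<mu> :: "real ^ 'p"
  assumes v: "0 < v"
  shows "normal_kernel v (x - \<mu>) * (1 - h / v * (x \<bullet> (x - \<mu>)) - h\<^sup>2 / (2 * v) * (norm x)\<^sup>2)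
    \<le> normal_kernel v ((1 + h) *\<^sub>R x - \<mu>)"
proof -
  have e: "(norm ((1 + h) *\<^sub>R x - \<mu>))\<^sup>2 = (norm (x - \<mu>))\<^sup>2 + 2 * h * (x \<bullet> (x - \<mu>)) + h\<^sup>2 * (norm x)\<^sup>2"
    unfolding power2_norm_eq_inner
    by (simp add: inner_diff_left inner_diff_right inner_commute[of \<mu> x] inner_add_left inner_add_right algebra_simps power2_eq_square del: dot_square_norm)
  let ?d = "h / v * (x \<bullet> (x - \<mu>)) + h\<^sup>2 / (2 * v) * (norm x)\<^sup>2"
  have "exp (- ((norm ((1 + h) *\<^sub>R x - \<mu>))\<^sup>2 / (2 * v))) = exp (- ((norm (x - \<mu>))\<^sup>2 / (2 * v))) * exp (- ?d)"
    unfolding exp_add[symmetric] e using v by (simp add: field_simps)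
  then have "normal_kernel v ((1 + h) *\<^sub>R x - \<mu>) = normal_kernel v (x - \<mu>) * exp (- ?d)"
    by (simp add: normal_kernel_def)
  moreover have "1 - h / v * (x \<bullet> (x - \<mu>)) - h\<^sup>2 / (2 * v) * (norm x)\<^sup>2 \<le> exp (- ?d)"
    using exp_ge_add_one_self[of "- ?d"] by linarith
  ultimately show ?thesis
    by (simp only: mult_left_mono normal_kernel_nonneg)
qed

text \<open>
  For smooth \<open>r\<close> this is Stein's integration by parts with the nonnegative term that contains \<open>r'\<close> dropped.  A dilation replaces the
  derivative: substituting \<open>x \<mapsto> (1 + h) x\<close> and using that \<open>r\<close> is nondecreasing gives
  \<open>(1 + h)\<^sup>p\<^sup>-\<^sup>2 \<integral> ratio x n ((1 + h) x - \<mu>) dx \<le> \<integral> ratio x n (x - \<mu>) dx\<close>.  Bounding the dilated kernel by its tangent and letting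
  \<open>h\<close> tend to \<open>0\<close> yields the claim.
\<close>

lemma stein_inequality:
  fixes \<mu> :: "real ^ 'p"
  assumes v: "0 < v" and p: "CARD('p) \<ge> 3"
  shows "(real CARD('p) - 2) * v * (\<integral>x. ratio x * normal_kernel v (x - \<mu>) \<partial>lborel)
    \<le> (\<integral>x. ratio x * (x \<bullet> (x - \<mu>)) * normal_kernel v (x - \<mu>) \<partial>lborel)"
proof -
  let ?n = "\<lambda>x. normal_kernel v (x - \<mu>)"
  define k where "k = CARD('p) - 2"
  define A where "A = (\<integral>x. ratio x * ?n x \<partial>lborel)"
  define B where "B = (\<integral>x. ratio x * (x \<bullet> (x - \<mu>)) * ?n x \<partial>lborel)"
  define C where "C = (\<integral>x. r (x \<bullet> x) * ?n x \<partial>lborel)"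
  have A: "0 \<le> A" unfolding A_def by (intro Bochner_Integration.integral_nonneg) (simp add: ratio_nonneg)
  have bound: "real k * A \<le> (1 + h) ^ k * (B / v + h * (C / (2 * v)))" if h: "0 < h" for h
  proof -
    define l where "l = 1 + h"
    have l: "1 < l" using h by (simp add: l_def)
    let ?f = "\<lambda>x. ratio x * ?n x"
    let ?g = "\<lambda>x. ratio x * ?n x - h / v * (ratio x * (x \<bullet> (x - \<mu>)) * ?n x) - h\<^sup>2 / (2 * v) * (r (x \<bullet> x) * ?n x)"
    have aff: "(lborel :: (real ^ 'p) measure) = density (distr lborel borel (\<lambda>x. l *\<^sub>R x)) (\<lambda>_. ennreal (l ^ CARD('p)))"
      using lborel_affine[of l "0 :: real ^ 'p"] l by simp
    have If: "integrable lborel ?f" by (rule integrable_ratio[OF v p])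
    have Ifl: "integrable lborel (\<lambda>x. ?f (l *\<^sub>R x))"
    proof -
      have "integrable (density (distr lborel borel (\<lambda>x. l *\<^sub>R x)) (\<lambda>_. ennreal (l ^ CARD('p)))) ?f"
        using If by (subst (asm) aff)
      then show ?thesis
        using l by (simp add: integrable_density integrable_distr_eq)
    qed
    have eq: "A = l ^ CARD('p) * (\<integral>x. ?f (l *\<^sub>R x) \<partial>lborel)"
    proof -
      have "A = (\<integral>x. ?f x \<partial>density (distr lborel borel (\<lambda>x. l *\<^sub>R x)) (\<lambda>_. ennreal (l ^ CARD('p))))"
        unfolding A_def by (subst aff) simp
      also have "\<dots> = l ^ CARD('p) * (\<integral>x. ?f (l *\<^sub>R x) \<partial>lborel)"
        using l by (simp add: integral_density integral_distr)
      finally show ?thesis .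
    qed
    have I: "integrable lborel (\<lambda>x. ratio x * (x \<bullet> (x - \<mu>)) * ?n x)" "integrable lborel (\<lambda>x. r (x \<bullet> x) * ?n x)"
      by (rule integrable_ratio_inner[OF v p] integrable_r_normal[OF v])+
    have int_g: "integrable lborel ?g" "(\<integral>x. ?g x \<partial>lborel) = A - h / v * B - h\<^sup>2 / (2 * v) * C"
      using If I by (simp_all add: A_def B_def C_def)
    have "(\<integral>x. ?g x \<partial>lborel) \<le> (\<integral>x. l\<^sup>2 * ?f (l *\<^sub>R x) \<partial>lborel)"
    proof (rule integral_mono_AE)
      show "AE x in lborel. ?g x \<le> l\<^sup>2 * ?f (l *\<^sub>R x)"
        using AE_lborel_singleton[of 0]
      proof eventually_elim
        case (elim x)
        have "?g x = ratio x * (?n x * (1 - h / v * (x \<bullet> (x - \<mu>)) - h\<^sup>2 / (2 * v) * (norm x)\<^sup>2))"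
          unfolding ratio_times_norm2[OF elim, symmetric] by (simp add: algebra_simps)
        also have "\<dots> \<le> ratio x * ?n (l *\<^sub>R x)"
          unfolding l_def by (intro mult_left_mono normal_kernel_dilate_ge v ratio_nonneg)
        also have "\<dots> \<le> l\<^sup>2 * ratio (l *\<^sub>R x) * ?n (l *\<^sub>R x)"
          using l by (intro mult_right_mono ratio_dilate) auto
        finally show ?case by (simp add: mult.assoc)
      qed
    qed (use int_g Ifl in simp_all)
    then have "l ^ k * (A - h / v * B - h\<^sup>2 / (2 * v) * C) \<le> l ^ k * (l\<^sup>2 * (\<integral>x. ?f (l *\<^sub>R x) \<partial>lborel))"
      unfolding int_g using l by (intro mult_left_mono) auto
    also have "\<dots> = A"
    proof -
      have "k + 2 = CARD('p)" using p by (simp add: k_def)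
      then have "l ^ k * l\<^sup>2 = l ^ CARD('p)" by (simp only: power_add[symmetric])
      then show ?thesis unfolding eq by (simp add: mult.assoc[symmetric])
    qed
    finally have 1: "l ^ k * A - A \<le> h * (l ^ k * (B / v + h * (C / (2 * v))))"
      by (simp add: algebra_simps power2_eq_square)
    \<comment> \<open>Bernoulli's inequality turns \<open>l ^ k - 1\<close> into the linear term \<open>k h\<close>, so that \<open>h\<close> can be divided out.\<close>
    have "1 + real k * h \<le> l ^ k" unfolding l_def using h by (intro Bernoulli_inequality) auto
    then have "(1 + real k * h) * A \<le> l ^ k * A" using A by (rule mult_right_mono)
    with 1 have "h * (real k * A) \<le> h * (l ^ k * (B / v + h * (C / (2 * v))))"
      by (simp add: algebra_simps)
    then show ?thesis using h by (simp add: l_def)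
  qed
  have "((\<lambda>h. (1 + h) ^ k * (B / v + h * (C / (2 * v)))) \<longlongrightarrow> (1 + 0) ^ k * (B / v + 0 * (C / (2 * v)))) (at_right 0)"
    by (intro tendsto_intros)
  moreover have "\<forall>\<^sub>F h in at_right 0. real k * A \<le> (1 + h) ^ k * (B / v + h * (C / (2 * v)))"
    by (rule eventually_mono[OF eventually_at_right_less]) (rule bound)
  ultimately have "real k * A \<le> (1 + 0) ^ k * (B / v + 0 * (C / (2 * v)))"
    by (intro tendsto_lowerbound) auto
  moreover have "real k = real CARD('p) - 2" using p by (simp add: k_def)
  ultimately show ?thesis
    using v by (simp add: A_def B_def field_simps)
qed

text \<open>
  The quantity \<open>v E (r (\<parallel>X\<parallel>\<^sup>2) / \<parallel>X\<parallel>\<^sup>2)\<close> for \<open>X\<close> normal with mean \<open>\<mu>\<close> and covariance \<open>v I\<close>.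
\<close>

definition shrinkage_gain :: "real ^ 'p \<Rightarrow> real \<Rightarrow> real" where
  "shrinkage_gain \<mu> v = v * (\<integral>x. ratio x * normal_kernel v (x - \<mu>) \<partial>lborel)"

lemma shrinkage_gain_nonneg: "0 < v \<Longrightarrow> 0 \<le> shrinkage_gain \<mu> v"
  unfolding shrinkage_gain_def
  by (intro mult_nonneg_nonneg Bochner_Integration.integral_nonneg) (simp_all add: ratio_nonneg)

lemma ennreal_shrinkage_gain:
  fixes \<mu> :: "real ^ 'p"
  assumes v: "0 < v" and p: "CARD('p) \<ge> 3"
  shows "ennreal (shrinkage_gain \<mu> v)
    = (\<integral>\<^sup>+x. ennreal (v * ratio (sqrt v *\<^sub>R x) * normal_kernel 1 (x - (1 / sqrt v) *\<^sub>R \<mu>)) \<partial>lborel)"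
proof -
  have sv: "0 < sqrt v" using v by simp
  have scale: "sqrt v ^ CARD('p) * normal_kernel v (sqrt v *\<^sub>R x - \<mu>) = normal_kernel 1 (x - (1 / sqrt v) *\<^sub>R \<mu>)" for x
  proof -
    have "sqrt v *\<^sub>R x - \<mu> = sqrt v *\<^sub>R (x - (1 / sqrt v) *\<^sub>R \<mu>)"
      using v by (simp add: scaleR_diff_right)
    moreover have "(2 * pi * v) powr (- (real CARD('p) / 2)) = (2 * pi) powr (- (real CARD('p) / 2)) / sqrt v ^ CARD('p)"
    proof -
      have "sqrt v ^ CARD('p) = v powr (real CARD('p) / 2)"
        using v by (simp add: powr_half_sqrt[symmetric] powr_realpow[symmetric] powr_powr)
      then show ?thesis using v by (simp add: powr_mult powr_minus field_simps)
    qed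
    ultimately show ?thesis
      using v by (simp add: normal_kernel_def power_mult_distrib)
  qed
  have "ennreal (shrinkage_gain \<mu> v) = (\<integral>\<^sup>+x. ennreal (v * (ratio x * normal_kernel v (x - \<mu>))) \<partial>lborel)"
    unfolding shrinkage_gain_def using integrable_ratio[OF v p, of \<mu>] v
    by (subst nn_integral_eq_integral) (auto simp: ratio_nonneg)
  also have "\<dots> = ennreal (sqrt v ^ CARD('p)) *
      (\<integral>\<^sup>+x. ennreal (v * (ratio (sqrt v *\<^sub>R x) * normal_kernel v (sqrt v *\<^sub>R x - \<mu>))) \<partial>lborel)"
    using sv by (subst nn_integral_dilate[of _ "sqrt v"]) simp_all
  also have "\<dots> = (\<integral>\<^sup>+x. ennreal (v * ratio (sqrt v *\<^sub>R x) * (sqrt v ^ CARD('p) * normal_kernel v (sqrt v *\<^sub>R x - \<mu>))) \<partial>lborel)"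
    using v by (subst nn_integral_cmult[symmetric]) (simp_all add: ennreal_mult[symmetric] ratio_nonneg mult_ac)
  finally show ?thesis unfolding scale .
qed

text \<open>
  After rescaling to unit variance, \<open>v\<close> enters in two places.  In \<open>r (v \<parallel>x\<parallel>\<^sup>2) / \<parallel>x\<parallel>\<^sup>2\<close> it acts through the monotonicity of \<open>r\<close>; and it moves the
  centre \<open>\<mu> / \<surd>v\<close> towards the origin, which helps because \<open>r t / t\<close> decreases.
\<close>

lemma shrinkage_gain_mono:
  fixes \<mu> :: "real ^ 'p"
  assumes v: "0 < v" and vw: "v \<le> w" and p: "CARD('p) \<ge> 3"
  shows "shrinkage_gain \<mu> v \<le> shrinkage_gain \<mu> w"
proof -
  have w: "0 < w" using v vw by simp
  have scaled: "c * ratio (sqrt c *\<^sub>R x) = r (c * (x \<bullet> x)) / (x \<bullet> x)" if "0 < c" for c and x :: "real ^ 'p"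
    using that by (simp add: ratio_def mult.assoc[symmetric])
  let ?K = "\<lambda>x :: real ^ 'p. w * ratio (sqrt w *\<^sub>R x)"
  have "ennreal (shrinkage_gain \<mu> v)
      \<le> (\<integral>\<^sup>+x. ennreal (?K x * normal_kernel 1 (x - (1 / sqrt v) *\<^sub>R \<mu>)) \<partial>lborel)"
    unfolding ennreal_shrinkage_gain[OF v p] scaled[OF v] scaled[OF w]
    using vw mono by (intro nn_integral_mono ennreal_leI mult_right_mono divide_right_mono)
      (auto intro!: monoD[OF mono] mult_right_mono)
  also have "\<dots> \<le> (\<integral>\<^sup>+x. ennreal (?K x * normal_kernel 1 (x - (sqrt v / sqrt w) *\<^sub>R ((1 / sqrt v) *\<^sub>R \<mu>))) \<partial>lborel)"
  proof (rule nn_integral_shift_antimono)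
    fix x y :: "real ^ 'p"
    assume x: "x \<noteq> 0" and xy: "norm x \<le> norm y"
    have "0 < w * (x \<bullet> x)" using w x by simp
    moreover have "w * (x \<bullet> x) \<le> w * (y \<bullet> y)"
      using w xy by (intro mult_left_mono) (auto simp: dot_square_norm intro!: power_mono)
    ultimately have "r (w * (y \<bullet> y)) / (w * (y \<bullet> y)) \<le> r (w * (x \<bullet> x)) / (w * (x \<bullet> x))"
      by (rule ratio_antimono)
    then have "r (w * (y \<bullet> y)) / (y \<bullet> y) / w \<le> r (w * (x \<bullet> x)) / (x \<bullet> x) / w"
      by (simp add: mult.commute)
    then show "?K y \<le> ?K x"
      unfolding scaled[OF w] using w by (simp only: divide_le_cancel)
  qed (use v vw w in \<open>auto simp: ratio_nonneg\<close>)
  also have "\<dots> = ennreal (shrinkage_gain \<mu> w)"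
    using v unfolding ennreal_shrinkage_gain[OF w p] by simp
  finally show ?thesis using shrinkage_gain_nonneg[OF w, of \<mu>] by (simp add: ennreal_le_iff)
qed

text \<open>
  The risk difference at variance \<open>v\<close> is at most \<open>a g(v) (a / v - 2 (p - 2))\<close>, with \<open>g\<close> the nondecreasing gain.  The second factor changes sign at
  \<open>v = a / (2 (p - 2))\<close>, so \<open>g(v)\<close> may be replaced by its value \<open>h\<close> there.  This makes the bound integrable in closed form over any
  mixture of variances, and it is stated with positive terms only.
\<close>

lemma normal_risk_baranchik:
  fixes \<mu> :: "real ^ 'p"
  assumes v: "0 < v" and a: "0 < a" and p: "CARD('p) \<ge> 3"
  defines "h \<equiv> shrinkage_gain \<mu> (a / (2 * (real CARD('p) - 2)))"
  shows "(\<integral>\<^sup>+x. ennreal (normal_kernel v (x - \<mu>)) * sq_loss \<mu> (baranchik a r x) \<partial>lborel)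
      + ennreal (2 * a * (real CARD('p) - 2) * h)
    \<le> (\<integral>\<^sup>+x. ennreal (normal_kernel v (x - \<mu>)) * sq_loss \<mu> x \<partial>lborel) + ennreal (a\<^sup>2 * h / v)"
proof -
  let ?n = "\<lambda>x. normal_kernel v (x - \<mu>)"
  define k where "k = real CARD('p) - 2"
  have k: "0 < k" using p by (simp add: k_def)
  have v0: "0 < a / (2 * k)" using a k by simp
  have h: "0 \<le> h" unfolding h_def using shrinkage_gain_nonneg[OF v0] by (simp add: k_def)
  define A where "A = (\<integral>x. ratio x * ?n x \<partial>lborel)"
  define B where "B = (\<integral>x. ratio x * (x \<bullet> (x - \<mu>)) * ?n x \<partial>lborel)"
  define S where "S = (\<integral>x. (norm (x - \<mu>))\<^sup>2 * ?n x \<partial>lborel)"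
  let ?g = "\<lambda>x. (norm (x - \<mu>))\<^sup>2 * ?n x - 2 * a * (ratio x * (x \<bullet> (x - \<mu>)) * ?n x) + a\<^sup>2 * (ratio x * ?n x)"
  have I: "integrable lborel (\<lambda>x. ratio x * ?n x)" "integrable lborel (\<lambda>x. (norm (x - \<mu>))\<^sup>2 * ?n x)"
     "integrable lborel (\<lambda>x. ratio x * (x \<bullet> (x - \<mu>)) * ?n x)"
    by (rule integrable_ratio[OF v p] integrable_ratio_inner[OF v p] integrable_norm2_normal_kernel[OF v])+
  have int_g: "integrable lborel ?g" "(\<integral>x. ?g x \<partial>lborel) = S - 2 * a * B + a\<^sup>2 * A"
    using I by (simp_all add: A_def B_def S_def)
  have pt: "AE x in lborel. ?n x * (norm (baranchik a r x - \<mu>))\<^sup>2 \<le> ?g x"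
    using AE_lborel_singleton[of 0]
  proof eventually_elim
    case (elim x)
    have b: "baranchik a r x - \<mu> = (x - \<mu>) - (a * ratio x) *\<^sub>R x"
      by (simp add: baranchik_def ratio_def algebra_simps)
    have "(norm (baranchik a r x - \<mu>))\<^sup>2
        = (norm (x - \<mu>))\<^sup>2 - 2 * a * (ratio x * (x \<bullet> (x - \<mu>))) + (a * ratio x)\<^sup>2 * (norm x)\<^sup>2"
      unfolding b power2_norm_eq_inner
      by (simp add: inner_diff_left inner_diff_right inner_commute[of \<mu> x] algebra_simps power2_eq_square del: dot_square_norm)
    also have "(a * ratio x)\<^sup>2 * (norm x)\<^sup>2 = a\<^sup>2 * ratio x * r (x \<bullet> x)"
      unfolding ratio_times_norm2[OF elim, symmetric] by (simp add: power2_eq_square)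
    also have "\<dots> \<le> a\<^sup>2 * ratio x"
      using le_1 by (intro mult_left_le) (auto simp: ratio_nonneg)
    finally have "?n x * (norm (baranchik a r x - \<mu>))\<^sup>2
        \<le> ?n x * ((norm (x - \<mu>))\<^sup>2 - 2 * a * (ratio x * (x \<bullet> (x - \<mu>))) + a\<^sup>2 * ratio x)"
      by (intro mult_left_mono) auto
    then show ?case by (simp add: algebra_simps)
  qed
  have g0: "AE x in lborel. 0 \<le> ?g x"
    using pt by eventually_elim (rule order_trans[rotated], assumption, simp)
  have "(\<integral>\<^sup>+x. ennreal (?n x) * sq_loss \<mu> (baranchik a r x) \<partial>lborel) \<le> (\<integral>\<^sup>+x. ennreal (?g x) \<partial>lborel)"
    using pt by (intro nn_integral_mono_AE) (auto simp: sq_loss_def ennreal_mult[symmetric] intro!: ennreal_leI elim!: eventually_mono)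
  also have "\<dots> = ennreal (S - 2 * a * B + a\<^sup>2 * A)"
    using nn_integral_eq_integral[OF int_g(1) g0] int_g(2) by simp
  finally have risk: "(\<integral>\<^sup>+x. ennreal (?n x) * sq_loss \<mu> (baranchik a r x) \<partial>lborel) \<le> ennreal (S - 2 * a * B + a\<^sup>2 * A)" .
  have nonneg: "0 \<le> S - 2 * a * B + a\<^sup>2 * A"
    using integral_nonneg_AE[OF g0] int_g(2) by simp
  have id: "(\<integral>\<^sup>+x. ennreal (?n x) * sq_loss \<mu> x \<partial>lborel) = ennreal S"
    unfolding S_def using I(2)
    by (subst nn_integral_eq_integral[symmetric]) (auto simp: sq_loss_def ennreal_mult[symmetric] mult.commute)
  have S0: "0 \<le> S" unfolding S_def by (intro Bochner_Integration.integral_nonneg) simp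
  have "S - 2 * a * B + a\<^sup>2 * A + 2 * a * k * h \<le> S + a\<^sup>2 * h / v"
  proof -
    have "k * v * A \<le> B" using stein_inequality[OF v p, of \<mu>] by (simp add: A_def B_def k_def)
    then have "2 * a * (k * v * A) \<le> 2 * a * B" using a by (intro mult_left_mono) auto
    \<comment> \<open>The two factors have opposite signs, since the first is nondecreasing, the second decreasing, and both vanish at \<open>v = a / (2 k)\<close>.\<close>
    moreover have "(v * A - h) * (a\<^sup>2 / v - 2 * a * k) \<le> 0"
    proof (cases "v \<le> a / (2 * k)")
      case True
      then have "v * A \<le> h"
        unfolding h_def k_def[symmetric] A_def using shrinkage_gain_mono[OF v True p, of \<mu>] by (simp add: shrinkage_gain_def)
      moreover have "2 * a * k \<le> a\<^sup>2 / v" using True v k a by (simp add: field_simps power2_eq_square)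
      ultimately show ?thesis by (intro mult_nonpos_nonneg) auto
    next
      case False
      then have "h \<le> v * A"
        unfolding h_def k_def[symmetric] A_def using shrinkage_gain_mono[OF v0 _ p, of v \<mu>] by (simp add: shrinkage_gain_def)
      moreover have "a\<^sup>2 / v \<le> 2 * a * k" using False v k a by (simp add: field_simps power2_eq_square)
      ultimately show ?thesis by (intro mult_nonneg_nonpos) auto
    qed
    moreover have "(v * A - h) * (a\<^sup>2 / v - 2 * a * k)
        = a\<^sup>2 * A - 2 * a * (k * v * A) - a\<^sup>2 * h / v + 2 * a * k * h"
    proof -
      define q where "q = a\<^sup>2 / v"
      have 1: "a\<^sup>2 = q * v" and 2: "a\<^sup>2 * h / v = h * q" using v by (simp_all add: q_def)
      show ?thesis unfolding 2 q_def[symmetric] unfolding 1 by (simp add: algebra_simps)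
    qed
    ultimately show ?thesis by linarith
  qed
  then have "ennreal (S - 2 * a * B + a\<^sup>2 * A) + ennreal (2 * a * k * h) \<le> ennreal S + ennreal (a\<^sup>2 * h / v)"
    using nonneg S0 h a k v by (simp add: ennreal_plus[symmetric] del: ennreal_plus)
  with risk show ?thesis
    unfolding id k_def[symmetric] by (meson add_right_mono order_trans)
qed

end

section \<open>The density p* as a mixture of normal densities\<close>

lemma integrable_cauchy_power:
  assumes b: "1 \<le> b"
  shows "integrable lborel (\<lambda>t :: real. (1 + t\<^sup>2) powr (- b))"
proof (rule Bochner_Integration.integrable_bound)
  show "integrable lborel (\<lambda>t :: real. inverse (1 + t\<^sup>2))"
    using integrable_inverse_1_plus_square by (simp add: set_integrable_def)
  show "AE t in lborel. norm ((1 + t\<^sup>2) powr (- b)) \<le> norm (inverse (1 + t\<^sup>2))"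
  proof (rule AE_I2)
    fix t :: real
    have "0 < 1 + t\<^sup>2" by (simp add: add_pos_nonneg)
    have "(1 + t\<^sup>2) powr (- b) \<le> (1 + t\<^sup>2) powr (- 1)"
      using b by (intro powr_mono) auto
    then show "norm ((1 + t\<^sup>2) powr (- b)) \<le> norm (inverse (1 + t\<^sup>2))"
      using \<open>0 < 1 + t\<^sup>2\<close> by (simp add: powr_minus)
  qed
qed simp

text \<open>
  The function \<open>t (1 + t\<^sup>2)\<^sup>-\<^sup>b\<close> vanishes at both ends, so its derivative integrates to \<open>0\<close>.  With \<open>2 b = p - 2\<close> the recursion is the source of the factor \<open>p - 3\<close>.
\<close>

lemma cauchy_power_recursion:
  assumes b: "1 \<le> b"
  shows "(2 * b - 1) * (\<integral>t. (1 + t\<^sup>2) powr (- b) \<partial>lborel) = 2 * b * (\<integral>t. (1 + t\<^sup>2) powr (- (b + 1)) \<partial>(lborel :: real measure))"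
proof -
  let ?g = "\<lambda>b t :: real. (1 + t\<^sup>2) powr (- b)"
  let ?f = "\<lambda>t. (1 - 2 * b) * ?g b t + 2 * b * ?g (b + 1) t"
  have pos: "0 < 1 + t\<^sup>2" for t :: real by (simp add: add_pos_nonneg)
  have I: "integrable lborel (?g b)" "integrable lborel (?g (b + 1))"
    using b by (intro integrable_cauchy_power; linarith)+
  have small: "\<bar>t * ?g b t\<bar> \<le> \<bar>inverse t\<bar>" for t :: real
  proof (cases "t = 0")
    case False
    have "?g b t \<le> (1 + t\<^sup>2) powr (- 1)" using b by (intro powr_mono) auto
    also have "\<dots> \<le> inverse (t\<^sup>2)" using pos[of t] False by (simp add: powr_minus)
    finally have "\<bar>t\<bar> * ?g b t \<le> \<bar>t\<bar> * inverse (t\<^sup>2)" by (rule mult_left_mono) simp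
    also have "\<dots> = \<bar>inverse t\<bar>"
      using False by (simp add: power2_eq_square abs_if field_simps)
    finally show ?thesis by (simp add: abs_mult)
  qed simp
  have lim: "((\<lambda>t. t * ?g b t) \<longlongrightarrow> 0) F" if "filterlim inverse (nhds 0) F" for F
    using that by (rule Lim_null_comparison[rotated, OF tendsto_norm_zero])
      (use small in \<open>auto intro!: always_eventually\<close>)
  have "(LBINT t=-\<infinity>..\<infinity>. ?f t) = 0 - 0"
  proof (rule interval_integral_FTC_integrable)
    fix t :: real
    have sq: "?g b t = (1 + t\<^sup>2) * ?g (b + 1) t"
      using powr_add[of "1 + t\<^sup>2" 1 "- (b + 1)"] pos[of t] by simp
    have "((\<lambda>t. t * ?g b t) has_real_derivative ?g b t - 2 * b * (t\<^sup>2 * ?g (b + 1) t)) (at t)"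
    proof -
      have "((\<lambda>t. 1 + t\<^sup>2) has_real_derivative 2 * t) (at t)"
        by (auto intro!: derivative_eq_intros)
      moreover have "- b - real 1 = - (b + 1)" by simp
      ultimately have "((\<lambda>t. ?g b t) has_real_derivative - b * ?g (b + 1) t * (2 * t)) (at t)"
        using DERIV_fun_powr[of "\<lambda>t. 1 + t\<^sup>2" "2 * t" t "- b"] pos by simp
      from DERIV_mult[OF DERIV_ident this]
      show ?thesis by (simp add: power2_eq_square algebra_simps)
    qed
    moreover have "t\<^sup>2 * ?g (b + 1) t = ?g b t - ?g (b + 1) t"
      unfolding sq by (simp add: algebra_simps)
    then have "?g b t - 2 * b * (t\<^sup>2 * ?g (b + 1) t) = ?f t"
      by (simp only:) (simp add: algebra_simps)
    ultimately show "((\<lambda>t. t * ?g b t) has_vector_derivative ?f t) (at t)"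
      by (simp only: has_real_derivative_iff_has_vector_derivative[symmetric])
    show "isCont ?f t"
      using pos[of t] by (intro continuous_intros) auto
  next
    show "set_integrable lborel (einterval (- \<infinity>) \<infinity>) ?f"
      using I by (simp add: set_integrable_def)
    show "(((\<lambda>t. t * ?g b t) \<circ> real_of_ereal) \<longlongrightarrow> 0) (at_right (- \<infinity>))"
      unfolding ereal_tendsto_simps by (rule lim) (rule filterlim_mono[OF tendsto_inverse_0 order_refl at_bot_le_at_infinity])
    show "(((\<lambda>t. t * ?g b t) \<circ> real_of_ereal) \<longlongrightarrow> 0) (at_left \<infinity>)"
      unfolding ereal_tendsto_simps by (rule lim) (rule tendsto_inverse_0_at_top[OF filterlim_ident])
  qed simp
  then have "(\<integral>t. ?f t \<partial>lborel) = 0"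
    by (simp add: interval_lebesgue_integral_def set_lebesgue_integral_def)
  moreover have "(\<integral>t. ?f t \<partial>lborel) = (1 - 2 * b) * (\<integral>t. ?g b t \<partial>lborel) + 2 * b * (\<integral>t. ?g (b + 1) t \<partial>lborel)"
    using I by simp
  ultimately show ?thesis by (simp add: algebra_simps)
qed

lemma nn_integral_cauchy_power_scaled:
  assumes b: "1 \<le> b" and z: "0 < z"
  shows "(\<integral>\<^sup>+t. ennreal ((1 + t\<^sup>2 * z) powr (- b)) \<partial>lborel)
    = ennreal (z powr (- 1 / 2) * (\<integral>t. (1 + t\<^sup>2) powr (- b) \<partial>lborel))"
proof -
  have "(\<integral>\<^sup>+t. ennreal ((1 + t\<^sup>2) powr (- b)) \<partial>lborel) = ennreal (\<integral>t. (1 + t\<^sup>2) powr (- b) \<partial>lborel)"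
    using integrable_cauchy_power[OF b] by (intro nn_integral_eq_integral) auto
  moreover have "(\<integral>\<^sup>+t. ennreal ((1 + t\<^sup>2 * z) powr (- b)) \<partial>lborel)
      = ennreal (1 / sqrt z) * (\<integral>\<^sup>+t. ennreal ((1 + (0 + (1 / sqrt z) * t)\<^sup>2 * z) powr (- b)) \<partial>lborel)"
    using z by (subst nn_integral_real_affine[where c = "1 / sqrt z" and t = 0]) simp_all
  moreover have "(0 + (1 / sqrt z) * t)\<^sup>2 * z = t\<^sup>2" for t
    using z by (simp add: power_divide)
  ultimately show ?thesis
    using z by (simp add: ennreal_mult[symmetric] powr_minus powr_half_sqrt inverse_eq_divide)
qed

text \<open>
  Weight and variance in the representation of \<open>normal_kernel z s / norm s\<close> as a mixture of normal kernels over real \<open>t\<close>.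
\<close>

definition mix_weight :: "nat \<Rightarrow> real \<Rightarrow> real \<Rightarrow> real" where
  "mix_weight p z t = 1 / sqrt (2 * pi) * (1 + t\<^sup>2 * z) powr (- (real p / 2))"

definition mix_variance :: "real \<Rightarrow> real \<Rightarrow> real" where
  "mix_variance z t = z / (1 + t\<^sup>2 * z)"

lemma mix_weight_nonneg: "0 \<le> mix_weight p z t"
  by (simp add: mix_weight_def)

lemma mix_variance_pos: "0 < z \<Longrightarrow> 0 < mix_variance z t"
  unfolding mix_variance_def by (intro divide_pos_pos add_pos_nonneg) auto

lemma measurable_mix [measurable]:
  "(\<lambda>(z, t). mix_weight p z t) \<in> borel_measurable (borel \<Otimes>\<^sub>M borel)"
  "(\<lambda>(z, t). mix_variance z t) \<in> borel_measurable (borel \<Otimes>\<^sub>M borel)"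
  unfolding mix_weight_def mix_variance_def case_prod_beta by measurable

text \<open>
  The factor \<open>1 / \<parallel>s\<parallel>\<close> is itself a Gaussian integral, \<open>\<integral> exp (- t\<^sup>2 \<parallel>s\<parallel>\<^sup>2 / 2) dt / \<surd>(2 \<pi>)\<close>, and each of its terms tilts the
  normal kernel to one of smaller variance.
\<close>

lemma normal_kernel_div_norm_mixture:
  fixes s :: "real ^ 'p"
  assumes z: "0 < z" and s: "s \<noteq> 0"
  shows "ennreal (normal_kernel z s / norm s)
    = (\<integral>\<^sup>+t. ennreal (mix_weight CARD('p) z t * normal_kernel (mix_variance z t) s) \<partial>lborel)"
proof -
  have eq: "mix_weight CARD('p) z t * normal_kernel (mix_variance z t) s
      = normal_kernel z s / norm s * normal_density 0 (1 / norm s) t" for t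
  proof -
    have "mix_weight CARD('p) z t * normal_kernel (mix_variance z t) s
        = 1 / sqrt (2 * pi) * (exp (- (t\<^sup>2 / 2 * (norm s)\<^sup>2)) * normal_kernel z s)"
      using normal_kernel_tilt[OF z, of "t\<^sup>2 / 2" s] by (simp add: mix_weight_def mix_variance_def)
    then show ?thesis
      using s by (simp add: normal_density_def power_divide real_sqrt_divide real_sqrt_mult field_simps)
  qed
  have "(\<integral>\<^sup>+t. ennreal (normal_kernel z s / norm s * normal_density 0 (1 / norm s) t) \<partial>lborel)
      = ennreal (normal_kernel z s / norm s) * (\<integral>\<^sup>+t. ennreal (normal_density 0 (1 / norm s) t) \<partial>lborel)"
    by (subst nn_integral_cmult[symmetric]) (simp_all add: ennreal_mult[symmetric])
  also have "(\<integral>\<^sup>+t. ennreal (normal_density 0 (1 / norm s) t) \<partial>lborel) = 1"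
    using s by (simp add: nn_integral_eq_integral)
  finally show ?thesis unfolding eq by simp
qed

context mixing_pair
begin

sublocale F: prob_space "Z_law p G H" by (rule prob_space_Z_law)

lemma pstar_risk_mixture:
  fixes \<mu> :: "real ^ 'p"
  assumes card: "p = CARD('p)" and [measurable]: "m \<in> borel_measurable borel"
  shows "pstar_risk m \<mu> = (\<integral>\<^sup>+z. \<integral>\<^sup>+t. ennreal (mix_weight p z t) *
      (\<integral>\<^sup>+x. ennreal (normal_kernel (mix_variance z t) (x - \<mu>)) * sq_loss \<mu> (m x) \<partial>lborel) \<partial>lborel \<partial>Z_law p G H)"
proof -
  let ?F = "Z_law p G H"
  interpret FL: pair_sigma_finite ?F "lborel :: (real ^ 'p) measure" ..
  have [measurable]: "(\<lambda>x. sq_loss \<mu> (m x)) \<in> borel_measurable borel"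
    unfolding sq_loss_def by measurable
  have "pstar_risk m \<mu> = (\<integral>\<^sup>+x. \<integral>\<^sup>+z. ennreal (normal_kernel z (x - \<mu>) / norm (x - \<mu>)) * sq_loss \<mu> (m x) \<partial>?F \<partial>lborel)"
    unfolding pstar_risk_def pstar_weight_def by (simp add: nn_integral_multc)
  also have "\<dots> = (\<integral>\<^sup>+x. \<integral>\<^sup>+z. \<integral>\<^sup>+t. ennreal (mix_weight p z t) *
      (ennreal (normal_kernel (mix_variance z t) (x - \<mu>)) * sq_loss \<mu> (m x)) \<partial>lborel \<partial>?F \<partial>lborel)"
    using AE_lborel_singleton[of \<mu>]
  proof (intro nn_integral_cong_AE, eventually_elim)
    case (elim x)
    show ?case using AE_Z_law_pos
    proof (intro nn_integral_cong_AE, eventually_elim)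
      case (elim z)
      show ?case
        using \<open>x \<noteq> \<mu>\<close>
        by (subst normal_kernel_div_norm_mixture[OF \<open>0 < z\<close>])
           (simp_all add: nn_integral_multc[symmetric] ennreal_mult mix_weight_nonneg card mult.assoc)
    qed
  qed
  also have "\<dots> = (\<integral>\<^sup>+z. \<integral>\<^sup>+x. \<integral>\<^sup>+t. ennreal (mix_weight p z t) *
      (ennreal (normal_kernel (mix_variance z t) (x - \<mu>)) * sq_loss \<mu> (m x)) \<partial>lborel \<partial>lborel \<partial>?F)"
    by (rule FL.Fubini') simp
  also have "\<dots> = (\<integral>\<^sup>+z. \<integral>\<^sup>+t. \<integral>\<^sup>+x. ennreal (mix_weight p z t) *
      (ennreal (normal_kernel (mix_variance z t) (x - \<mu>)) * sq_loss \<mu> (m x)) \<partial>lborel \<partial>lborel \<partial>?F)"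
    by (intro nn_integral_cong lborel_pair.Fubini') simp
  finally show ?thesis by (simp add: nn_integral_cmult)
qed

lemma nn_integral_mix_weight:
  assumes p: "4 \<le> p"
  shows "(\<integral>\<^sup>+z. \<integral>\<^sup>+t. ennreal (mix_weight p z t) \<partial>lborel \<partial>Z_law p G H)
      = ennreal (1 / sqrt (2 * pi) * (\<integral>t. (1 + t\<^sup>2) powr (- (real p / 2)) \<partial>lborel)) * (\<integral>\<^sup>+z. ennreal (z powr (- 1 / 2)) \<partial>Z_law p G H)"
    and "(\<integral>\<^sup>+z. \<integral>\<^sup>+t. ennreal (mix_weight p z t / mix_variance z t) \<partial>lborel \<partial>Z_law p G H)
      = ennreal (1 / sqrt (2 * pi) * (\<integral>t. (1 + t\<^sup>2) powr (- ((real p - 2) / 2)) \<partial>lborel)) * (\<integral>\<^sup>+z. ennreal (z powr (- 3 / 2)) \<partial>Z_law p G H)"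
proof -
  let ?F = "Z_law p G H"
  let ?J = "\<lambda>b. \<integral>t. (1 + t\<^sup>2) powr (- b) \<partial>(lborel :: real measure)"
  have J: "0 \<le> ?J b" for b by (intro Bochner_Integration.integral_nonneg) simp
  have 1: "AE z in ?F. (\<integral>\<^sup>+t. ennreal (mix_weight p z t) \<partial>lborel)
      = ennreal (1 / sqrt (2 * pi) * ?J (real p / 2)) * ennreal (z powr (- 1 / 2))"
    using AE_Z_law_pos
  proof eventually_elim
    case (elim z)
    have "(\<integral>\<^sup>+t. ennreal (mix_weight p z t) \<partial>lborel)
        = ennreal (1 / sqrt (2 * pi)) * (\<integral>\<^sup>+t. ennreal ((1 + t\<^sup>2 * z) powr (- (real p / 2))) \<partial>lborel)"
      unfolding mix_weight_def by (subst nn_integral_cmult[symmetric]) (simp_all add: ennreal_mult[symmetric])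
    then show ?case
      using nn_integral_cauchy_power_scaled[OF _ elim, of "real p / 2"] p J[of "real p / 2"]
      by (simp add: ennreal_mult[symmetric] mult_ac)
  qed
  have 2: "AE z in ?F. (\<integral>\<^sup>+t. ennreal (mix_weight p z t / mix_variance z t) \<partial>lborel)
      = ennreal (1 / sqrt (2 * pi) * ?J ((real p - 2) / 2)) * ennreal (z powr (- 3 / 2))"
    using AE_Z_law_pos
  proof eventually_elim
    case (elim z)
    have "mix_weight p z t / mix_variance z t = 1 / sqrt (2 * pi) / z * (1 + t\<^sup>2 * z) powr (- ((real p - 2) / 2))" for t
    proof -
      have "0 < 1 + t\<^sup>2 * z" using elim by (simp add: add_pos_nonneg)
      moreover have "- ((real p - 2) / 2) = - (real p / 2) + 1" by (simp add: field_simps)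
      ultimately have "(1 + t\<^sup>2 * z) powr (- ((real p - 2) / 2)) = (1 + t\<^sup>2 * z) powr (- (real p / 2)) * (1 + t\<^sup>2 * z)"
        by (simp only: powr_add) simp
      then show ?thesis by (simp add: mix_weight_def mix_variance_def)
    qed
    then have "(\<integral>\<^sup>+t. ennreal (mix_weight p z t / mix_variance z t) \<partial>lborel)
        = ennreal (1 / sqrt (2 * pi) / z) * (\<integral>\<^sup>+t. ennreal ((1 + t\<^sup>2 * z) powr (- ((real p - 2) / 2))) \<partial>lborel)"
      using elim by (subst nn_integral_cmult[symmetric]) (simp_all add: ennreal_mult[symmetric])
    also have "\<dots> = ennreal (1 / sqrt (2 * pi) / z) * ennreal (z powr (- 1 / 2) * ?J ((real p - 2) / 2))"
      using p by (subst nn_integral_cauchy_power_scaled[OF _ elim]) auto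
    also have "z powr (- 3 / 2) = z powr (- 1 / 2) / z"
      using elim powr_diff[of z "- 1 / 2" 1] by simp
    then have "ennreal (1 / sqrt (2 * pi) / z) * ennreal (z powr (- 1 / 2) * ?J ((real p - 2) / 2))
        = ennreal (1 / sqrt (2 * pi) * ?J ((real p - 2) / 2)) * ennreal (z powr (- 3 / 2))"
      using elim J[of "(real p - 2) / 2"] by (simp add: ennreal_mult[symmetric] mult_ac)
    finally show ?case .
  qed
  show "(\<integral>\<^sup>+z. \<integral>\<^sup>+t. ennreal (mix_weight p z t) \<partial>lborel \<partial>?F)
      = ennreal (1 / sqrt (2 * pi) * ?J (real p / 2)) * (\<integral>\<^sup>+z. ennreal (z powr (- 1 / 2)) \<partial>?F)"
    by (subst nn_integral_cong_AE[OF 1]) (simp add: nn_integral_cmult)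
  show "(\<integral>\<^sup>+z. \<integral>\<^sup>+t. ennreal (mix_weight p z t / mix_variance z t) \<partial>lborel \<partial>?F)
      = ennreal (1 / sqrt (2 * pi) * ?J ((real p - 2) / 2)) * (\<integral>\<^sup>+z. ennreal (z powr (- 3 / 2)) \<partial>?F)"
    by (subst nn_integral_cong_AE[OF 2]) (simp add: nn_integral_cmult)
qed

text \<open>
  Mix the bound at each fixed variance.  What remains is \<open>a E (1 / V) \<le> 2 (p - 2)\<close> for the mixing variable \<open>V\<close>.  In terms of \<open>Z\<close>, the mean
  of \<open>1 / V\<close> is \<open>(p - 2) / (p - 3) * E (Z\<^sup>-\<^sup>3\<^sup>/\<^sup>2) / E (Z\<^sup>-\<^sup>1\<^sup>/\<^sup>2)\<close>, which is the hypothesis on \<open>a\<close>.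
\<close>

lemma pstar_risk_baranchik:
  fixes \<mu> :: "real ^ 'p"
  assumes card: "p = CARD('p)" and p: "4 \<le> p" and r: "shrinkage_function r"
    and i3: "integrable (Z_law p G H) (\<lambda>z. z powr (- 3 / 2))"
    and a: "0 < a" and a_le: "a \<le> 2 * (real p - 3) *
      ((\<integral>z. z powr (- 1 / 2) \<partial>Z_law p G H) / (\<integral>z. z powr (- 3 / 2) \<partial>Z_law p G H))"
  shows "pstar_risk (baranchik a r) \<mu> \<le> pstar_risk (\<lambda>x. x) \<mu>"
proof -
  interpret shrinkage_function r by (rule r)
  let ?F = "Z_law p G H"
  define h where "h = shrinkage_gain \<mu> (a / (2 * (real p - 2)))"
  have h: "0 \<le> h" unfolding h_def using a p by (intro shrinkage_gain_nonneg) simp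
  define E1 where "E1 = (\<integral>z. z powr (- 1 / 2) \<partial>?F)"
  define E3 where "E3 = (\<integral>z. z powr (- 3 / 2) \<partial>?F)"
  define J0 where "J0 = (\<integral>t. (1 + t\<^sup>2) powr (- (real p / 2)) \<partial>(lborel :: real measure))"
  define J1 where "J1 = (\<integral>t. (1 + t\<^sup>2) powr (- ((real p - 2) / 2)) \<partial>(lborel :: real measure))"
  have nn: "0 \<le> E1" "0 \<le> E3" "0 \<le> J0" "0 \<le> J1"
    unfolding E1_def E3_def J0_def J1_def by (auto intro!: Bochner_Integration.integral_nonneg)
  have i1: "integrable ?F (\<lambda>z. z powr (- 1 / 2))"
  proof (rule Bochner_Integration.integrable_bound)
    show "integrable ?F (\<lambda>z. 1 + z powr (- 3 / 2))" using i3 by simp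
    show "AE z in ?F. norm (z powr (- 1 / 2)) \<le> norm (1 + z powr (- 3 / 2))"
      using AE_Z_law_pos
    proof eventually_elim
      case (elim z)
      show ?case
      proof (cases "z \<le> 1")
        case True
        then have "z powr (- 1 / 2) \<le> z powr (- 3 / 2)" using elim by (intro powr_mono') auto
        then show ?thesis by simp
      next
        case False
        then have "z powr (- 1 / 2) \<le> z powr 0" by (intro powr_mono) auto
        with elim show ?thesis by (simp add: add_increasing2)
      qed
    qed
  qed simp
  let ?R = "\<lambda>m v. (\<integral>\<^sup>+x. ennreal (normal_kernel v (x - \<mu>)) * sq_loss \<mu> (m x) \<partial>lborel)"
  let ?W = "\<lambda>z t. ennreal (mix_weight p z t)" and ?V = mix_variance
  have [measurable]: "baranchik a r \<in> borel_measurable borel"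
    unfolding baranchik_def[abs_def] by measurable
  have [measurable]: "(\<lambda>v. ?R m v) \<in> borel_measurable borel" if [measurable]: "m \<in> borel_measurable borel" for m
    unfolding sq_loss_def by measurable
  define T1 where "T1 = 2 * a * (real p - 2) * h * (1 / sqrt (2 * pi) * J0 * E1)"
  define T2 where "T2 = a\<^sup>2 * h * (1 / sqrt (2 * pi) * J1 * E3)"
  have T1: "(\<integral>\<^sup>+z. \<integral>\<^sup>+t. ?W z t * ennreal (2 * a * (real p - 2) * h) \<partial>lborel \<partial>?F) = ennreal T1"
  proof -
    have "(\<integral>\<^sup>+z. \<integral>\<^sup>+t. ?W z t * ennreal (2 * a * (real p - 2) * h) \<partial>lborel \<partial>?F)
        = (\<integral>\<^sup>+z. \<integral>\<^sup>+t. ?W z t \<partial>lborel \<partial>?F) * ennreal (2 * a * (real p - 2) * h)"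
      by (simp add: nn_integral_multc)
    also have "(\<integral>\<^sup>+z. \<integral>\<^sup>+t. ?W z t \<partial>lborel \<partial>?F) = ennreal (1 / sqrt (2 * pi) * J0) * ennreal E1"
      using nn_integral_mix_weight(1)[OF p] nn_integral_eq_integral[OF i1] by (simp add: J0_def E1_def)
    finally show ?thesis
      using nn a p h unfolding T1_def by (simp add: ennreal_mult[symmetric] mult_ac)
  qed
  have T2: "(\<integral>\<^sup>+z. \<integral>\<^sup>+t. ?W z t * ennreal (a\<^sup>2 * h / ?V z t) \<partial>lborel \<partial>?F) = ennreal T2"
  proof -
    have "(\<integral>\<^sup>+z. \<integral>\<^sup>+t. ?W z t * ennreal (a\<^sup>2 * h / ?V z t) \<partial>lborel \<partial>?F)
        = (\<integral>\<^sup>+z. \<integral>\<^sup>+t. ennreal (mix_weight p z t / ?V z t) * ennreal (a\<^sup>2 * h) \<partial>lborel \<partial>?F)"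
      using AE_Z_law_pos
    proof (intro nn_integral_cong_AE, eventually_elim)
      case (elim z)
      have "?W z t * ennreal (a\<^sup>2 * h / ?V z t) = ennreal (mix_weight p z t / ?V z t) * ennreal (a\<^sup>2 * h)" for t
        using mix_variance_pos[OF \<open>0 < z\<close>, of t] h mix_weight_nonneg[of p z t]
        by (simp add: ennreal_mult[symmetric])
      then show ?case by simp
    qed
    also have "\<dots> = (\<integral>\<^sup>+z. \<integral>\<^sup>+t. ennreal (mix_weight p z t / ?V z t) \<partial>lborel \<partial>?F) * ennreal (a\<^sup>2 * h)"
      by (simp add: nn_integral_multc)
    also have "(\<integral>\<^sup>+z. \<integral>\<^sup>+t. ennreal (mix_weight p z t / ?V z t) \<partial>lborel \<partial>?F) = ennreal (1 / sqrt (2 * pi) * J1) * ennreal E3"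
      using nn_integral_mix_weight(2)[OF p] nn_integral_eq_integral[OF i3] by (simp add: J1_def E3_def)
    finally show ?thesis
      using nn h unfolding T2_def by (simp add: ennreal_mult[symmetric] mult_ac)
  qed
  have "T2 \<le> T1"
  proof -
    have "E3 \<noteq> 0" using a a_le unfolding E3_def[symmetric] by auto
    then have "a * E3 \<le> 2 * (real p - 3) * E1"
      using a_le nn unfolding E1_def[symmetric] E3_def[symmetric] by (simp add: field_simps)
    moreover have J: "(real p - 3) * J1 = (real p - 2) * J0"
    proof -
      have eq: "(real p - 2) / 2 + 1 = real p / 2" "2 * ((real p - 2) / 2) = real p - 2"
        by (simp_all add: field_simps)
      show ?thesis
        using cauchy_power_recursion[of "(real p - 2) / 2", unfolded eq] p
        unfolding J0_def J1_def by simp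
    qed
    ultimately have "a * E3 * J1 \<le> 2 * (real p - 3) * E1 * J1" using nn by (intro mult_right_mono) auto
    also have "\<dots> = 2 * ((real p - 3) * J1) * E1" by simp
    also have "\<dots> = 2 * (real p - 2) * J0 * E1" unfolding J by simp
    finally have "(a * h / sqrt (2 * pi)) * (a * E3 * J1) \<le> (a * h / sqrt (2 * pi)) * (2 * (real p - 2) * J0 * E1)"
      using a h by (intro mult_left_mono) auto
    then show ?thesis by (simp add: T1_def T2_def power2_eq_square mult_ac)
  qed
  have "pstar_risk (baranchik a r) \<mu> + ennreal T1
      = (\<integral>\<^sup>+z. \<integral>\<^sup>+t. ?W z t * (?R (baranchik a r) (?V z t) + ennreal (2 * a * (real p - 2) * h)) \<partial>lborel \<partial>?F)"
    unfolding T1[symmetric]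
    by (simp add: pstar_risk_mixture[OF card] distrib_left nn_integral_add)
  also have "\<dots> \<le> (\<integral>\<^sup>+z. \<integral>\<^sup>+t. ?W z t * (?R (\<lambda>x. x) (?V z t) + ennreal (a\<^sup>2 * h / ?V z t)) \<partial>lborel \<partial>?F)"
    using AE_Z_law_pos
  proof (intro nn_integral_mono_AE, eventually_elim)
    case (elim z)
    show ?case
      using normal_risk_baranchik[OF mix_variance_pos[OF \<open>0 < z\<close>] a, where \<mu> = \<mu>] p card
      by (intro nn_integral_mono mult_left_mono) (auto simp: h_def)
  qed
  also have "\<dots> = pstar_risk (\<lambda>x. x) \<mu> + ennreal T2"
    unfolding T2[symmetric]
    by (simp add: pstar_risk_mixture[OF card] distrib_left nn_integral_add)
  also have "\<dots> \<le> pstar_risk (\<lambda>x. x) \<mu> + ennreal T1"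
    using \<open>T2 \<le> T1\<close> by (intro add_left_mono ennreal_leI)
  finally have "ennreal T1 + pstar_risk (baranchik a r) \<mu> \<le> ennreal T1 + pstar_risk (\<lambda>x. x) \<mu>"
    by (simp add: add.commute)
  then show ?thesis by (simp add: ennreal_add_left_cancel_le)
qed

end

section \<open>The two domination results\<close>

lemma shrinkage_function_truncate:
  assumes bd: "\<forall>t>0. 0 \<le> r t \<and> r t \<le> (1 :: real)" and mono: "mono_on {0<..} r"
    and anti: "antimono_on {0<..} (\<lambda>t. r t / t)"
  shows "shrinkage_function (\<lambda>t. if 0 < t then r t else 0)"
proof
  show "mono (\<lambda>t. if 0 < t then r t else 0)"
    using bd mono by (auto simp: mono_def mono_on_def)
  fix s t :: real assume "0 < s" "s \<le> t"
  then show "(if 0 < t then r t else 0) / t \<le> (if 0 < s then r s else 0) / s"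
    using anti by (auto simp: monotone_on_def)
qed (use bd in auto)

text \<open>
  At \<open>x = 0\<close> both estimates are \<open>0\<close>, whatever the scalar factor; elsewhere \<open>x \<bullet> x > 0\<close>.
\<close>

lemma baranchik_truncate: "baranchik a (\<lambda>t. if 0 < t then r t else 0) = baranchik a r"
  by (auto simp: baranchik_def fun_eq_iff)

text \<open>
  Far from the origin \<open>0 < a r (\<parallel>x\<parallel>\<^sup>2) < \<parallel>x\<parallel>\<^sup>2\<close>, so the estimator strictly shortens \<open>x\<close>.  Together with strict concavity of the loss this
  gives a strict improvement at \<open>\<mu> = 0\<close>, even where the quadratic risks coincide.
\<close>

lemma baranchik_moves_norm:
  fixes r :: "real \<Rightarrow> real"
  assumes bd: "\<forall>t>0. 0 \<le> r t \<and> r t \<le> 1" and mono: "mono_on {0<..} r" and ex: "\<exists>t>0. r t \<noteq> 0" and a: "0 < a"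
  shows "\<not> (AE x in lborel. norm (baranchik a r x - (0 :: real ^ 'p)) = norm (x - 0))"
proof
  obtain t0 where t0: "0 < t0" "r t0 \<noteq> 0" using ex by blast
  define R where "R = max a t0"
  have R: "0 < R" using a by (simp add: R_def)
  assume "AE x in lborel. norm (baranchik a r x - (0 :: real ^ 'p)) = norm (x - 0)"
  then have "AE x :: real ^ 'p in lborel. x \<in> cball 0 (sqrt R)"
  proof eventually_elim
    case (elim x)
    show ?case
    proof (rule ccontr)
      assume "x \<notin> cball 0 (sqrt R)"
      then have "(sqrt R)\<^sup>2 < (norm x)\<^sup>2" using R by (intro power_strict_mono) auto
      then have "R < (norm x)\<^sup>2" using R by simp
      then have xx: "a < x \<bullet> x" "t0 < x \<bullet> x" by (auto simp: R_def dot_square_norm)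
      then have x: "0 < x \<bullet> x" using t0 by linarith
      have "r t0 \<le> r (x \<bullet> x)" using mono t0 xx x by (auto simp: mono_on_def)
      moreover have "0 < r t0" using bd t0 by (auto simp: less_le)
      ultimately have r: "0 < r (x \<bullet> x)" "r (x \<bullet> x) \<le> 1" using bd x by auto
      have "0 < a * r (x \<bullet> x) / (x \<bullet> x)" using r a x by simp
      moreover have "a * r (x \<bullet> x) / (x \<bullet> x) < 1"
      proof -
        have "a * r (x \<bullet> x) \<le> a * 1" using r a by (intro mult_left_mono) auto
        then show ?thesis using xx x by (simp only: pos_divide_less_eq)
      qed
      ultimately have "\<bar>1 - a * r (x \<bullet> x) / (x \<bullet> x)\<bar> * norm x < 1 * norm x"
        using x by (intro mult_strict_right_mono) auto
      with elim show False
        by (simp only: baranchik_def norm_scaleR diff_zero mult_1 less_irrefl)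
    qed
  qed
  then have "emeasure lborel (UNIV :: (real ^ 'p) set) \<le> emeasure lborel (cball (0 :: real ^ 'p) (sqrt R))"
    by (intro emeasure_mono_AE) auto
  moreover have "emeasure lborel (cball (0 :: real ^ 'p) (sqrt R)) < \<infinity>"
    by (intro emeasure_bounded_finite) simp
  ultimately show False by simp
qed

context mixing_pair
begin

lemma risk_plug_in:
  fixes m :: "real ^ 'p \<Rightarrow> real ^ 'p"
  assumes card: "p = CARD('p)" and [measurable]: "m \<in> borel_measurable borel"
    and pX: "\<And>s :: real ^ 'p. p_X ((norm s)\<^sup>2) = SN G s" and qY: "\<And>s :: real ^ 'p. q_Y ((norm s)\<^sup>2) = SN H s"
  shows "risk (location_family (\<lambda>s. p_X ((norm s)\<^sup>2))) (L1_loss q_Y) (plug_in q_Y m) \<mu> = L1_risk m \<mu>"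
proof -
  have [measurable]: "(SN G :: real ^ 'p \<Rightarrow> real) \<in> borel_measurable borel"
    using measurable_SN[OF G[unfolded card]] .
  have [measurable]: "mixed_L1_distance H \<in> borel_measurable borel"
    using H by (rule measurable_mixed_distance_slope)
  show ?thesis
    unfolding risk_def location_family_def L1_risk_def L1_loss_plug_in[OF H[unfolded card] qY] pX
    by (subst nn_integral_density) simp_all
qed

text \<open>
  The value \<open>K = 0\<close>, which arises when the kernel is not integrable, is included: then no estimator dominates another.
\<close>

lemma risk_pstar:
  obtains K where "0 \<le> K" "\<And>m (\<mu> :: real ^ 'p). p = CARD('p) \<Longrightarrow> m \<in> borel_measurable borel \<Longrightarrow>
    risk (location_family (pstar (Z_law p G H))) sq_loss m \<mu> = ennreal K * pstar_risk m \<mu>"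
proof -
  let ?F = "Z_law p G H"
  define K where "K = 1 / integral\<^sup>L lborel (pstar_kernel ?F :: real ^ 'p \<Rightarrow> real)"
  have nn: "0 \<le> pstar_kernel ?F s" for s :: "real ^ 'p"
    unfolding pstar_kernel_def set_lebesgue_integral_def
    by (intro mult_nonneg_nonneg Bochner_Integration.integral_nonneg) auto
  have K: "0 \<le> K" unfolding K_def using nn by (simp add: Bochner_Integration.integral_nonneg)
  have [measurable]: "(pstar_kernel ?F :: real ^ 'p \<Rightarrow> real) \<in> borel_measurable borel"
    unfolding pstar_kernel_def[abs_def] set_lebesgue_integral_def by measurable
  have eq: "pstar ?F = (\<lambda>s :: real ^ 'p. K * pstar_kernel ?F s)"
    by (simp add: pstar_def K_def fun_eq_iff Let_def)
  show thesis
  proof (rule that[OF K])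
    fix m :: "real ^ 'p \<Rightarrow> real ^ 'p" and \<mu> :: "real ^ 'p"
    assume card: "p = CARD('p)" and [measurable]: "m \<in> borel_measurable borel"
    have "risk (location_family (pstar ?F)) sq_loss m \<mu>
        = (\<integral>\<^sup>+x. ennreal (K * pstar_kernel ?F (x - \<mu>)) * sq_loss \<mu> (m x) \<partial>lborel)"
      unfolding risk_def location_family_def eq sq_loss_def
      by (subst nn_integral_density) simp_all
    also have "\<dots> = (\<integral>\<^sup>+x. ennreal K * (pstar_weight (x - \<mu>) * sq_loss \<mu> (m x)) \<partial>lborel)"
    proof (rule nn_integral_cong_AE)
      show "AE x in lborel. ennreal (K * pstar_kernel ?F (x - \<mu>)) * sq_loss \<mu> (m x)
          = ennreal K * (pstar_weight (x - \<mu>) * sq_loss \<mu> (m x))"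
        using AE_lborel_singleton[of \<mu>]
      proof eventually_elim
        case (elim x)
        then have "ennreal (pstar_kernel ?F (x - \<mu>)) = pstar_weight (x - \<mu>)"
          using ennreal_pstar_kernel[OF _ card, of "x - \<mu>"] by (simp add: pstar_weight_def)
        then show ?case using K nn[of "x - \<mu>"] by (simp add: ennreal_mult mult.assoc)
      qed
    qed
    also have "\<dots> = ennreal K * pstar_risk m \<mu>"
      unfolding pstar_risk_def by (rule nn_integral_cmult) (simp add: sq_loss_def)
    finally show "risk (location_family (pstar ?F)) sq_loss m \<mu> = ennreal K * pstar_risk m \<mu>" .
  qed
qed

end

theorem theorem5p2:
  fixes G H :: "real measure"
    and p_X q_Y :: "real \<Rightarrow> real"
    and M :: "'w measure" and Z :: "'w \<Rightarrow> real"
  assumes "mixing_law CARD('p::finite) G" and "mixing_law CARD('p) H"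
    and "\<And>s :: real ^ 'p. p_X ((norm s)\<^sup>2) = SN G s"
    and "\<And>s :: real ^ 'p. q_Y ((norm s)\<^sup>2) = SN H s"
    and "prob_space M" and "Z \<in> borel_measurable M"
    and "distr M borel Z = Z_law CARD('p) G H"
  shows
    "(CARD('p) > 1 \<longrightarrow>
       (\<forall>\<mu>hat :: real ^ 'p \<Rightarrow> real ^ 'p. \<mu>hat \<in> borel_measurable borel \<longrightarrow>
          dominates (location_family (pstar (distr M borel Z))) sq_loss \<mu>hat (\<lambda>x. x) \<longrightarrow>
          dominates (location_family (\<lambda>s. p_X ((norm s)\<^sup>2))) (L1_loss q_Y)
            (plug_in q_Y \<mu>hat) (plug_in q_Y (\<lambda>x. x))))
     \<and>
     (\<forall>(a::real) (r :: real \<Rightarrow> real).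
          (\<forall>t>0. 0 \<le> r t \<and> r t \<le> 1) \<and> (\<exists>t>0. r t \<noteq> 0) \<and>
          mono_on {0<..} r \<and> antimono_on {0<..} (\<lambda>t. r t / t) \<and>
          CARD('p) \<ge> 4 \<and>
          integrable M (\<lambda>\<omega>. Z \<omega> powr (1/2)) \<and> integrable M (\<lambda>\<omega>. Z \<omega> powr (- 3/2)) \<and>
          0 < a \<and>
          a \<le> 2 * (real CARD('p) - 3) *
                ((\<integral>\<omega>. Z \<omega> powr (- 1/2) \<partial>M) / (\<integral>\<omega>. Z \<omega> powr (- 3/2) \<partial>M)) \<longrightarrow>
          dominates (location_family (\<lambda>s :: real ^ 'p. p_X ((norm s)\<^sup>2))) (L1_loss q_Y)
            (plug_in q_Y (baranchik a r)) (plug_in q_Y (\<lambda>x. x)))"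
proof -
  interpret mixing_pair "CARD('p)" G H
    using assms(1,2) by unfold_locales simp_all
  let ?F = "Z_law CARD('p) G H"
  have [measurable]: "Z \<in> borel_measurable M" by (rule assms(6))
  note risk_L1 = risk_plug_in[OF refl _ assms(3,4)]
  obtain K where K: "0 \<le> K" and risk_sq: "\<And>m (\<mu> :: real ^ 'p). m \<in> borel_measurable borel \<Longrightarrow>
    risk (location_family (pstar ?F)) sq_loss m \<mu> = ennreal K * pstar_risk m \<mu>"
    using risk_pstar by (metis (no_types))
  show ?thesis
  proof (intro conjI impI allI)
    fix \<mu>hat :: "real ^ 'p \<Rightarrow> real ^ 'p"
    assume m: "\<mu>hat \<in> borel_measurable borel"
    assume "dominates (location_family (pstar (distr M borel Z))) sq_loss \<mu>hat (\<lambda>x. x)"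
    then have le: "ennreal K * pstar_risk \<mu>hat \<mu> \<le> ennreal K * pstar_risk (\<lambda>x. x) \<mu>"
      and ex: "\<exists>\<mu>. ennreal K * pstar_risk \<mu>hat \<mu> < ennreal K * pstar_risk (\<lambda>x. x) \<mu>" for \<mu>
      unfolding dominates_def assms(7) by (simp_all add: risk_sq m)
    obtain \<mu>0 where less: "ennreal K * pstar_risk \<mu>hat \<mu>0 < ennreal K * pstar_risk (\<lambda>x. x) \<mu>0"
      using ex by blast
    \<comment> \<open>The strict inequality at \<open>\<mu>0\<close> rules out the degenerate normalizing constant.\<close>
    have "K \<noteq> 0" using less by auto
    with K have K': "0 < ennreal K" "ennreal K \<noteq> \<top>" by auto
    have "pstar_risk \<mu>hat \<mu> \<le> pstar_risk (\<lambda>x. x) \<mu>" for \<mu>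
      using le[of \<mu>] K' by (subst (asm) ennreal_mult_le_mult_iff) auto
    moreover have "pstar_risk \<mu>hat \<mu>0 < pstar_risk (\<lambda>x. x) \<mu>0"
      using less mult_left_mono[of "pstar_risk (\<lambda>x. x) \<mu>0" "pstar_risk \<mu>hat \<mu>0" "ennreal K"]
      by (auto simp: not_le[symmetric])
    ultimately show "dominates (location_family (\<lambda>s. p_X ((norm s)\<^sup>2))) (L1_loss q_Y)
        (plug_in q_Y \<mu>hat) (plug_in q_Y (\<lambda>x. x))"
      using L1_risk_improvement(1,2)[OF refl m] unfolding dominates_def
      by (auto simp: risk_L1 m)
  next
    fix a :: real and r :: "real \<Rightarrow> real"
    assume "(\<forall>t>0. 0 \<le> r t \<and> r t \<le> 1) \<and> (\<exists>t>0. r t \<noteq> 0) \<and>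
          mono_on {0<..} r \<and> antimono_on {0<..} (\<lambda>t. r t / t) \<and>
          CARD('p) \<ge> 4 \<and>
          integrable M (\<lambda>\<omega>. Z \<omega> powr (1/2)) \<and> integrable M (\<lambda>\<omega>. Z \<omega> powr (- 3/2)) \<and>
          0 < a \<and>
          a \<le> 2 * (real CARD('p) - 3) *
                ((\<integral>\<omega>. Z \<omega> powr (- 1/2) \<partial>M) / (\<integral>\<omega>. Z \<omega> powr (- 3/2) \<partial>M))"
    then have bd: "\<forall>t>0. 0 \<le> r t \<and> r t \<le> 1" and ex: "\<exists>t>0. r t \<noteq> 0"
      and r_mono: "mono_on {0<..} r" and anti: "antimono_on {0<..} (\<lambda>t. r t / t)"
      and p: "4 \<le> CARD('p)" and i3: "integrable M (\<lambda>\<omega>. Z \<omega> powr (- 3/2))" and a: "0 < a"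
      and a_le: "a \<le> 2 * (real CARD('p) - 3) *
                ((\<integral>\<omega>. Z \<omega> powr (- 1/2) \<partial>M) / (\<integral>\<omega>. Z \<omega> powr (- 3/2) \<partial>M))"
      by auto
    let ?r = "\<lambda>t. if 0 < t then r t else 0"
    interpret shrinkage_function ?r
      using bd r_mono anti by (rule shrinkage_function_truncate)
    have "(baranchik a ?r :: real ^ 'p \<Rightarrow> _) \<in> borel_measurable borel"
      unfolding baranchik_def[abs_def] by measurable
    then have m: "(baranchik a r :: real ^ 'p \<Rightarrow> _) \<in> borel_measurable borel"
      unfolding baranchik_truncate .
    have "pstar_risk (baranchik a ?r) \<mu> \<le> pstar_risk (\<lambda>x. x) \<mu>" for \<mu> :: "real ^ 'p"
    proof (rule pstar_risk_baranchik[OF refl p])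
      show "shrinkage_function ?r" by unfold_locales
      show "integrable ?F (\<lambda>z. z powr (- 3 / 2))"
        using i3 unfolding assms(7)[symmetric] by (subst integrable_distr_eq) simp_all
      show "a \<le> 2 * (real CARD('p) - 3) * ((\<integral>z. z powr (- 1 / 2) \<partial>?F) / (\<integral>z. z powr (- 3 / 2) \<partial>?F))"
        using a_le unfolding assms(7)[symmetric] by (simp add: integral_distr)
    qed (rule a)
    then have le: "pstar_risk (baranchik a r) \<mu> \<le> pstar_risk (\<lambda>x. x) \<mu>" for \<mu> :: "real ^ 'p"
      unfolding baranchik_truncate .
    have "L1_risk (baranchik a r) (0 :: real ^ 'p) < L1_risk (\<lambda>x. x) (0 :: real ^ 'p)"
      using L1_risk_improvement(3)[OF refl m le baranchik_moves_norm[OF bd r_mono ex a]] .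
    then show "dominates (location_family (\<lambda>s :: real ^ 'p. p_X ((norm s)\<^sup>2))) (L1_loss q_Y)
            (plug_in q_Y (baranchik a r)) (plug_in q_Y (\<lambda>x. x))"
      using L1_risk_improvement(1)[OF refl m le] unfolding dominates_def
      by (auto simp: risk_L1 m)
  qed
qed

end
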